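(* Let $\Phi$ be a simple, stationary point process on $\mathbb{R}^d$ of intensity $\lambda$. For every integer $k\ge1$ there exist constants $c(\lambda)$ and $c(\lambda,k)$, not depending on the distribution of $\Phi$ (that is, the same constants serve for all such $\Phi$ of intensity $\lambda$), such that: (i) $0<c(\lambda)\le r_c^1(\Phi)$ provided $\Phi$ is $\alpha$-weakly sub-Poisson; and (ii) $r_c^k(\Phi)\le c(\lambda,k)<\infty$ provided $\Phi$ is $\nu$-weakly sub-Poisson.
   Context: A point process $\Phi$ on the $d$-dimensional Euclidean space $\mathbb{R}^d$ is a random element of the space of Radon (locally finite) counting measures on $\mathbb{R}^d$; we write $X\in\Phi$ for its points (atoms, counted with multiplicity). It is simple if almost surely $\Phi(\{x\})\le 1$ for all $x\in\mathbb{R}^d$; stationary if its law is invariant under all translations of $\mathbb{R}^d$. A stationary process has intensity $\lambda$ ($0<\lambda<\infty$) if $\mathsf{E}(\Phi(B))=\lambda\|B\|$ for all Borel $B$, where $\|\cdot\|$ is Lebesgue measure. "bBs" means bounded Borel subset of $\mathbb{R}^d$. $\Phi$ is $\nu$-weakly sub-Poisson if $\mathsf{P}(\Phi(B)=0)\le e^{-\mathsf{E}(\Phi(B))}$ for every bBs $B$. $\Phi$ is $\alpha$-weakly sub-Poisson if $\mathsf{E}\big(\prod_{i=1}^n\Phi(B_i)\big)\le\prod_{i=1}^n\mathsf{E}(\Phi(B_i))$ for every $n\ge1$ and all mutually disjoint bBs $B_1,\dots,B_n$. For $r\ge 0$ and integer $k\ge 1$ let $B_r(x)$ be the Euclidean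 ball of radius $r$ centred at $x$, let $V_{\Phi,r}(y):=\sum_{X_i\in\Phi}\mathbf{1}[y\in B_r(X_i)]$, and let $C_k(\Phi,r):=\{y: V_{\Phi,r}(y)\ge k\}$ be the $k$-covered set. A subset of $\mathbb{R}^d$ percolates if it contains an unbounded connected subset. The critical radius for $k$-percolation is $r_c^k(\Phi):=\inf\{r:\mathsf{P}(C_k(\Phi,r)\text{ percolates})>0\}$.
   Formalization: Part (ii) is stated only for dimension d ≥ 2; for d = 1 it is false, since the homogeneous Poisson process on the line is simple, stationary and ν-weakly sub-Poisson but has infinite critical radius for every k. *)

theory Defs
  imports "HOL-Probability.Probability"
begin

definition bBs :: "'a::euclidean_space set \<Rightarrow> bool" where
  "bBs B \<longleftrightarrow> B \<in> sets borel \<and> bounded B"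

definition counting_measures :: "'a::euclidean_space measure set" where
  "counting_measures =
     {\<mu>. sets \<mu> = sets borel \<and> (\<forall>B. bBs B \<longrightarrow> (\<exists>n::nat. emeasure \<mu> B = of_nat n))}"

text \<open>
  The measurable space of Radon counting measures: the \<open>\<sigma>\<close>-algebra is the smallest one making
  all evaluations at bounded Borel sets measurable (as in the library's \<open>subprob_algebra\<close>).
\<close>

definition config_space :: "'a::euclidean_space measure measure" where
  "config_space =
     (SUP B \<in> Collect bBs. vimage_algebra counting_measures (\<lambda>\<mu>. emeasure \<mu> B) borel)"

text \<open>
  All the notions below depend on a point process only through its law, so a point process is
  represented by that law, i.e. by a probability measure \<open>P\<close> on \<open>config_space\<close>; the process
  itself is then the canonical random element \<open>\<mu>\<close> under \<open>P\<close>.  Quantifying over \<open>P\<close> covers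
  random elements defined on arbitrary probability spaces, see \<open>point_process_distr\<close>.
\<close>

definition point_process :: "'a::euclidean_space measure measure \<Rightarrow> bool" where
  "point_process P \<longleftrightarrow> prob_space P \<and> sets P = sets config_space"

lemma point_process_distr:
  assumes "prob_space M" and "X \<in> measurable M config_space"
  shows "point_process (distr M config_space X)"
  using assms by (simp add: point_process_def prob_space.prob_space_distr)

definition mean_count :: "'a::euclidean_space measure measure \<Rightarrow> 'a set \<Rightarrow> ennreal" where
  "mean_count P B = (\<integral>\<^sup>+ \<mu>. emeasure \<mu> B \<partial>P)"

definition simple_process :: "'a::euclidean_space measure measure \<Rightarrow> bool" where
  "simple_process P \<longleftrightarrow> (AE \<mu> in P. \<forall>x. emeasure \<mu> {x} \<le> 1)"

definition stationary_process :: "'a::euclidean_space measure measure \<Rightarrow> bool" where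
  "stationary_process P \<longleftrightarrow>
     (\<forall>v. distr P config_space (\<lambda>\<mu>. distr \<mu> borel (\<lambda>x. x + v)) = P)"

definition has_intensity :: "'a::euclidean_space measure measure \<Rightarrow> real \<Rightarrow> bool" where
  "has_intensity P l \<longleftrightarrow>
     0 < l \<and> (\<forall>B \<in> sets borel. mean_count P B = ennreal l * emeasure lborel B)"

text \<open>The function \<open>x \<mapsto> e\<^sup>-\<^sup>x\<close> on \<open>[0,\<infinity>]\<close>.\<close>

definition exp_minus :: "ennreal \<Rightarrow> real" where
  "exp_minus x = (if x = \<infinity> then 0 else exp (- enn2real x))"

definition nu_weakly_sub_Poisson :: "'a::euclidean_space measure measure \<Rightarrow> bool" where
  "nu_weakly_sub_Poisson P \<longleftrightarrow>
     (\<forall>B. bBs B \<longrightarrow> measure P {\<mu> \<in> space P. emeasure \<mu> B = 0} \<le> exp_minus (mean_count P B))"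

definition alpha_weakly_sub_Poisson :: "'a::euclidean_space measure measure \<Rightarrow> bool" where
  "alpha_weakly_sub_Poisson P \<longleftrightarrow>
     (\<forall>n\<ge>1. \<forall>B :: nat \<Rightarrow> 'a set.
        (\<forall>i \<in> {1..n}. bBs (B i)) \<and> disjoint_family_on B {1..n} \<longrightarrow>
        (\<integral>\<^sup>+ \<mu>. (\<Prod>i = 1..n. emeasure \<mu> (B i)) \<partial>P) \<le> (\<Prod>i = 1..n. mean_count P (B i)))"

text \<open>
  The sum over the points of \<open>\<mu>\<close> is a sum over its atoms, each weighted by its multiplicity.
  Balls are closed.
\<close>

definition coverage :: "'a::euclidean_space measure \<Rightarrow> real \<Rightarrow> 'a \<Rightarrow> ennreal" where
  "coverage \<mu> r y =
     (\<Sum>\<^sub>\<infinity>x \<in> {x. emeasure \<mu> {x} > 0}. emeasure \<mu> {x} * indicator (cball x r) y)"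

definition covered_set :: "nat \<Rightarrow> 'a::euclidean_space measure \<Rightarrow> real \<Rightarrow> 'a set" where
  "covered_set k \<mu> r = {y. coverage \<mu> r y \<ge> of_nat k}"

definition percolates :: "'a::euclidean_space set \<Rightarrow> bool" where
  "percolates S \<longleftrightarrow> (\<exists>T \<subseteq> S. connected T \<and> \<not> bounded T)"

text \<open>Extended-real valued, so that the infimum of the empty set is \<open>\<infinity>\<close>.\<close>

definition critical_radius :: "nat \<Rightarrow> 'a::euclidean_space measure measure \<Rightarrow> ereal" where
  "critical_radius k P =
     (INF r \<in> {r. r \<ge> 0 \<and> measure P {\<mu> \<in> space P. percolates (covered_set k \<mu> r)} > 0}. ereal r)"

end

theory Submission
  imports Defs "HOL-Library.Transitive_Closure_Table"
begin

text \<open>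
  Space is cut into cubic cells of side \<open>s\<close>, and the number of self-avoiding walks of length \<open>n\<close> of
  adjacent cells (diagonal neighbours included) from a given cell is at most \<open>M\<^sup>n\<close>.

  For \<open>r < s / 2\<close>, percolation of the 1-covered set produces, for every \<open>n\<close>, a walk of \<open>n + 1\<close> distinct
  cells each containing a point; by \<open>\<alpha>\<close>-weak sub-Poissonianity a given such walk occurs with probability
  at most \<open>(l s\<^sup>d)\<^bsup>n+1\<^esup>\<close>, so for small \<open>s\<close> percolation has probability zero.

  For the upper bound, \<open>\<nu>\<close>-weak sub-Poissonianity bounds the probability that \<open>n\<close> given cells are
  all empty by \<open>exp (- n l s\<^sup>d)\<close>. If the component of the origin in the complement of the
  closed empty cells is bounded, unicoherence of Euclidean space gives a connected set of empty cells
  that meets both half-axes, hence a walk of \<open>j + 1\<close> distinct empty cells from the \<open>j\<close>-th cell of the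
  positive half-axis, for some \<open>j\<close>; for large \<open>s\<close> this has probability at most \<open>1/3\<close>. An unbounded component
  has at least \<open>k\<close> points of the process close to each of its points, which gives \<open>k\<close>-coverage.

  As \<open>measure\<close> vanishes on non-measurable sets, the upper bound also needs measurability of the
  percolation event.
\<close>

subsection \<open>Counting measures\<close>

lemma bBs_Int: "bBs A \<Longrightarrow> B \<in> sets borel \<Longrightarrow> bBs (A \<inter> B)"
  and bBs_Diff: "bBs A \<Longrightarrow> B \<in> sets borel \<Longrightarrow> bBs (A - B)"
  and bBs_cball: "bBs (cball x r)"
  and bBs_singleton: "bBs {x}"
  by (auto simp: bBs_def intro: bounded_subset)

lemma counting_measuresD:
  assumes "\<mu> \<in> counting_measures"
  shows "sets \<mu> = sets borel" "space \<mu> = UNIV"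
    "bBs B \<Longrightarrow> \<exists>n::nat. emeasure \<mu> B = of_nat n"
    "bBs B \<Longrightarrow> emeasure \<mu> B \<noteq> \<infinity>"
proof -
  show *: "sets \<mu> = sets borel" and **: "bBs B \<Longrightarrow> \<exists>n::nat. emeasure \<mu> B = of_nat n" for B
    using assms by (auto simp: counting_measures_def)
  show "space \<mu> = UNIV"
    using sets_eq_imp_space_eq[OF *] by simp
  show "bBs B \<Longrightarrow> emeasure \<mu> B \<noteq> \<infinity>"
    using **[of B] by auto
qed

lemma counting_measure_zero_or_ge_1:
  assumes "\<mu> \<in> counting_measures" "bBs B"
  shows "emeasure \<mu> B = 0 \<or> emeasure \<mu> B \<ge> 1"
proof -
  obtain n :: nat where "emeasure \<mu> B = of_nat n"
    using counting_measuresD(3)[OF assms] by blast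
  then show ?thesis
    by (cases n) auto
qed

text \<open>The masses of the shrinking balls decrease to the mass of \<open>B \<inter> {x}\<close>,
  which is 0; being integers, they reach 0 at a finite stage.\<close>

lemma counting_measure_null_ball:
  assumes \<mu>: "\<mu> \<in> counting_measures" and B: "bBs B" and null: "emeasure \<mu> (B \<inter> {x}) = 0"
  shows "\<exists>e>0. emeasure \<mu> (B \<inter> ball x e) = 0"
proof -
  define A where "A n = B \<inter> ball x (1 / real (Suc n))" for n
  have bA: "bBs (A n)" for n
    using B by (auto simp: A_def intro: bBs_Int)
  have "(INF n. emeasure \<mu> (A n)) = emeasure \<mu> (\<Inter>n. A n)"
  proof (rule INF_emeasure_decseq)
    show "range A \<subseteq> sets \<mu>"
      using bA counting_measuresD(1)[OF \<mu>] by (auto simp: bBs_def)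
    show "decseq A"
      unfolding A_def decseq_def by (intro allI impI Int_mono subset_ball) (auto simp: frac_le)
    show "emeasure \<mu> (A i) \<noteq> \<infinity>" for i
      using counting_measuresD(4)[OF \<mu> bA] .
  qed
  also have "(\<Inter>n. A n) = B \<inter> {x}"
  proof -
    have "y = x" if "\<forall>n. dist x y < 1 / real (Suc n)" for y
    proof (rule ccontr)
      assume "y \<noteq> x"
      then obtain n where "inverse (real (Suc n)) < dist x y"
        using reals_Archimedean[of "dist x y"] by auto
      with that show False
        by (metis inverse_eq_divide not_less_iff_gr_or_eq)
    qed
    then show ?thesis
      by (auto simp: A_def)
  qed
  finally have "(INF n. emeasure \<mu> (A n)) < 1"
    using null by simp
  then obtain n where "emeasure \<mu> (A n) < 1"
    by (auto simp: INF_less_iff)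
  then have "emeasure \<mu> (A n) = 0"
    using counting_measure_zero_or_ge_1[OF \<mu> bA, of n] by auto
  then show ?thesis
    by (intro exI[of _ "1 / real (Suc n)"]) (auto simp: A_def)
qed

text \<open>Otherwise every point, also of \<open>closure B\<close> outside \<open>B\<close>, has a
  ball whose trace on \<open>B\<close> is null. Finitely many of these balls cover the compact
  closure, so \<open>B\<close> itself would be null. Thus a counting measure has no diffuse
  part.\<close>

lemma counting_measure_atom_exists:
  assumes \<mu>: "\<mu> \<in> counting_measures" and B: "bBs B" and pos: "emeasure \<mu> B > 0"
  shows "\<exists>x\<in>B. emeasure \<mu> {x} > 0"
proof (rule ccontr)
  assume "\<not> ?thesis"
  then have "emeasure \<mu> (B \<inter> {x}) = 0" for x
    by (cases "x \<in> B") auto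
  then obtain e where e: "\<And>x. e x > 0" "\<And>x. emeasure \<mu> (B \<inter> ball x (e x)) = 0"
    using counting_measure_null_ball[OF \<mu> B] by metis
  have "compact (closure B)"
    using B by (auto simp: bBs_def)
  moreover have "closure B \<subseteq> (\<Union>x\<in>closure B. ball x (e x))"
    using e(1) by force
  ultimately obtain D where D: "finite D" "closure B \<subseteq> (\<Union>x\<in>D. ball x (e x))"
    by (metis (no_types, lifting) compactE_image open_ball)
  have meas: "B \<inter> ball x (e x) \<in> sets \<mu>" for x
    using bBs_Int[OF B, of "ball x (e x)"] counting_measuresD(1)[OF \<mu>] by (simp add: bBs_def)
  have "B = (\<Union>x\<in>D. B \<inter> ball x (e x))"
    using D(2) closure_subset[of B] by blast
  then have "emeasure \<mu> B = emeasure \<mu> (\<Union>x\<in>D. B \<inter> ball x (e x))"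
    by (rule arg_cong)
  also have "\<dots> \<le> (\<Sum>x\<in>D. emeasure \<mu> (B \<inter> ball x (e x)))"
    using D(1) meas by (intro emeasure_subadditive_finite) blast+
  also have "\<dots> = 0"
    using e(2) by simp
  finally show False
    using pos by simp
qed

text \<open>Every atom has mass at least 1, so the integer mass of \<open>B\<close> bounds the
  number of its atoms.\<close>

lemma finite_counting_measure_atoms:
  assumes \<mu>: "\<mu> \<in> counting_measures" and B: "bBs B"
  shows "finite {x\<in>B. emeasure \<mu> {x} > 0}"
proof -
  obtain n :: nat where n: "emeasure \<mu> B = of_nat n"
    using counting_measuresD(3)[OF \<mu> B] by blast
  have "card G \<le> n" if G: "G \<subseteq> {x\<in>B. emeasure \<mu> {x} > 0}" "finite G" for G
  proof -
    have "of_nat (card G) = (\<Sum>x\<in>G. 1::ennreal)"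
      by simp
    also have "\<dots> \<le> (\<Sum>x\<in>G. emeasure \<mu> {x})"
    proof (rule sum_mono)
      fix x assume "x \<in> G"
      then show "1 \<le> emeasure \<mu> {x}"
        using G(1) counting_measure_zero_or_ge_1[OF \<mu> bBs_singleton, of x] by auto
    qed
    also have "\<dots> = emeasure \<mu> G"
      using G counting_measuresD(1)[OF \<mu>] by (subst emeasure_eq_sum_singleton) auto
    also have "\<dots> \<le> emeasure \<mu> B"
      using G B counting_measuresD(1)[OF \<mu>] by (intro emeasure_mono) (auto simp: bBs_def)
    finally show ?thesis
      using n by simp
  qed
  then show ?thesis
    using finite_if_finite_subsets_card_bdd by blast
qed

lemma counting_measure_eq_sum_atoms:
  assumes \<mu>: "\<mu> \<in> counting_measures" and B: "bBs B"
  shows "emeasure \<mu> B = (\<Sum>x | x \<in> B \<and> emeasure \<mu> {x} > 0. emeasure \<mu> {x})"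
proof -
  define A where "A = {x\<in>B. emeasure \<mu> {x} > 0}"
  have fA: "finite A"
    unfolding A_def by (rule finite_counting_measure_atoms[OF assms])
  then have sA: "A \<in> sets borel"
    by (simp add: finite_imp_closed borel_closed)
  have "emeasure \<mu> (B - A) = 0"
    using counting_measure_atom_exists[OF \<mu> bBs_Diff[OF B sA]] by (force simp: A_def)
  moreover have "emeasure \<mu> B = emeasure \<mu> A + emeasure \<mu> (B - A)"
    using B sA counting_measuresD(1)[OF \<mu>]
    by (subst plus_emeasure) (auto simp: bBs_def A_def intro!: arg_cong[of _ _ "emeasure \<mu>"])
  moreover have "emeasure \<mu> A = (\<Sum>x\<in>A. emeasure \<mu> {x})"
    using fA counting_measuresD(1)[OF \<mu>] by (subst emeasure_eq_sum_singleton) auto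
  ultimately show ?thesis
    by (simp add: A_def)
qed

section \<open>Covered sets as superlevel sets of ball counts\<close>

lemma coverage_eq_emeasure_cball:
  assumes \<mu>: "\<mu> \<in> counting_measures"
  shows "coverage \<mu> r y = emeasure \<mu> (cball y r)"
proof -
  have "coverage \<mu> r y = (\<Sum>\<^sub>\<infinity>x \<in> {x\<in>cball y r. emeasure \<mu> {x} > 0}. emeasure \<mu> {x})"
    unfolding coverage_def
    by (rule infsum_cong_neutral) (auto simp: indicator_def dist_commute split: if_splits)
  also have "\<dots> = emeasure \<mu> (cball y r)"
    using finite_counting_measure_atoms[OF \<mu> bBs_cball]
    by (subst counting_measure_eq_sum_atoms[OF \<mu> bBs_cball]) simp
  finally show ?thesis .
qed

lemma covered_set_eq:
  assumes "\<mu> \<in> counting_measures"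
  shows "covered_set k \<mu> r = {y. emeasure \<mu> (cball y r) \<ge> of_nat k}"
  using coverage_eq_emeasure_cball[OF assms] by (simp add: covered_set_def)

text \<open>Upper semicontinuity of ball counts in centre and radius jointly: nearby balls lie in a
  slightly larger ball about \<open>x\<close>, and continuity from above removes the enlargement.
  Closedness of the covered set uses \<open>e = 0\<close>, the measurability argument uses vanishing
  enlargements.\<close>

lemma covered_set_limit:
  assumes \<mu>: "\<mu> \<in> counting_measures" and y: "y \<longlonglongrightarrow> x" and e: "e \<longlonglongrightarrow> 0"
    and le: "\<And>n::nat. of_nat k \<le> emeasure \<mu> (cball (y n) (r + e n))"
  shows "x \<in> covered_set k \<mu> r"
proof -
  define A where "A n = cball x (r + 1 / real (Suc n))" for n
  have bA: "bBs (A n)" for n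
    by (simp add: A_def bBs_cball)
  have "(INF n. emeasure \<mu> (A n)) = emeasure \<mu> (\<Inter>n. A n)"
  proof (rule INF_emeasure_decseq)
    show "range A \<subseteq> sets \<mu>"
      using bA counting_measuresD(1)[OF \<mu>] by (auto simp: bBs_def)
    show "decseq A"
      unfolding A_def decseq_def by (intro allI impI subset_cball) (auto simp: frac_le)
    show "emeasure \<mu> (A i) \<noteq> \<infinity>" for i
      using counting_measuresD(4)[OF \<mu> bA] .
  qed
  also have "(\<Inter>n. A n) = cball x r"
  proof -
    have "dist x z \<le> r" if "\<forall>n. dist x z \<le> r + 1 / real (Suc n)" for z
    proof (rule field_le_epsilon)
      fix d :: real assume "d > 0"
      then obtain n where "inverse (real (Suc n)) < d"
        using reals_Archimedean by blast
      with that[rule_format, of n] show "dist x z \<le> r + d"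
        by (simp add: inverse_eq_divide)
    qed
    moreover have "cball x r \<subseteq> A n" for n
      unfolding A_def by (intro subset_cball) simp
    ultimately show ?thesis
      by (intro equalityI subsetI INT_I) (simp_all add: A_def subset_iff del: of_nat_Suc)
  qed
  finally have eq: "(INF n. emeasure \<mu> (A n)) = emeasure \<mu> (cball x r)" .
  have "of_nat k \<le> emeasure \<mu> (A n)" for n
  proof -
    define d where "d = 1 / real (Suc n)"
    have "d > 0" by (simp add: d_def)
    have "\<forall>\<^sub>F m in sequentially. dist (y m) x < d / 2" "\<forall>\<^sub>F m in sequentially. dist (e m) 0 < d / 2"
      using tendstoD[OF y, of "d / 2"] tendstoD[OF e, of "d / 2"] \<open>d > 0\<close> by auto
    then have "\<forall>\<^sub>F m in sequentially. dist (y m) x < d / 2 \<and> dist (e m) 0 < d / 2"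
      by eventually_elim auto
    then obtain m where m: "dist (y m) x < d / 2" "dist (e m) 0 < d / 2"
      by (auto dest: eventually_happens)
    have "cball (y m) (r + e m) \<subseteq> A n"
    proof
      fix z assume "z \<in> cball (y m) (r + e m)"
      then have "dist x z \<le> r + d"
        using m dist_triangle[of x z "y m"] by (auto simp: dist_commute dist_real_def)
      then show "z \<in> A n"
        by (simp add: A_def d_def)
    qed
    then have "emeasure \<mu> (cball (y m) (r + e m)) \<le> emeasure \<mu> (A n)"
      using bA counting_measuresD(1)[OF \<mu>] by (intro emeasure_mono) (auto simp: bBs_def)
    then show ?thesis
      using le[of m] by order
  qed
  then have "of_nat k \<le> emeasure \<mu> (cball x r)"
    unfolding eq[symmetric] by (rule INF_greatest)
  then show ?thesis
    by (simp add: covered_set_eq[OF \<mu>])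
qed

lemma closed_covered_set:
  assumes \<mu>: "\<mu> \<in> counting_measures"
  shows "closed (covered_set k \<mu> r)"
  unfolding closed_sequential_limits
proof (intro allI impI, elim conjE)
  fix y l assume "\<forall>n. y n \<in> covered_set k \<mu> r" "y \<longlonglongrightarrow> l"
  then show "l \<in> covered_set k \<mu> r"
    by (intro covered_set_limit[OF \<mu>, of y _ "\<lambda>_. 0"]) (auto simp: covered_set_eq[OF \<mu>])
qed

text \<open>With \<open>D\<close> countable this expresses the hitting event by countably many ball
  counts. The radius is enlarged because the covered set may meet \<open>L\<close> only outside
  \<open>D\<close>; conversely, compactness yields a limit of the centres, which is covered at
  radius \<open>r\<close>.\<close>

lemma covered_set_meets_compact_iff:
  assumes \<mu>: "\<mu> \<in> counting_measures" and L: "compact L" and D: "D \<subseteq> L" "L \<subseteq> closure D"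
  shows "covered_set k \<mu> r \<inter> L \<noteq> {} \<longleftrightarrow>
    (\<forall>n. \<exists>y\<in>D. of_nat k \<le> emeasure \<mu> (cball y (r + 1 / real (Suc n))))"
proof
  assume "covered_set k \<mu> r \<inter> L \<noteq> {}"
  then obtain y where y: "y \<in> L" "of_nat k \<le> emeasure \<mu> (cball y r)"
    by (auto simp: covered_set_eq[OF \<mu>])
  show "\<forall>n. \<exists>y\<in>D. of_nat k \<le> emeasure \<mu> (cball y (r + 1 / real (Suc n)))"
  proof
    fix n
    have "y \<in> closure D" using y(1) D by auto
    then obtain z where z: "z \<in> D" "dist z y < 1 / real (Suc n)"
      unfolding closure_approachable by (metis of_nat_0_less_iff zero_less_Suc zero_less_divide_1_iff)
    have "cball y r \<subseteq> cball z (r + 1 / real (Suc n))"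
    proof
      fix w assume "w \<in> cball y r"
      then show "w \<in> cball z (r + 1 / real (Suc n))"
        using z(2) dist_triangle[of z w y] by auto
    qed
    then have "emeasure \<mu> (cball y r) \<le> emeasure \<mu> (cball z (r + 1 / real (Suc n)))"
      using counting_measuresD(1)[OF \<mu>] by (intro emeasure_mono) auto
    then show "\<exists>y\<in>D. of_nat k \<le> emeasure \<mu> (cball y (r + 1 / real (Suc n)))"
      using y(2) z(1) order_trans by blast
  qed
next
  assume "\<forall>n. \<exists>y\<in>D. of_nat k \<le> emeasure \<mu> (cball y (r + 1 / real (Suc n)))"
  then obtain y where y: "\<And>n. y n \<in> D" "\<And>n. of_nat k \<le> emeasure \<mu> (cball (y n) (r + 1 / real (Suc n)))"
    by metis
  then obtain x h where x: "x \<in> L" "strict_mono h" "(y \<circ> h) \<longlonglongrightarrow> x"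
    using L D(1) unfolding compact_def by (metis subsetD)
  have "(\<lambda>n. 1 / real (Suc (h n))) \<longlonglongrightarrow> 0"
    using LIMSEQ_subseq_LIMSEQ[OF LIMSEQ_inverse_real_of_nat x(2)] by (simp add: o_def inverse_eq_divide)
  then have "x \<in> covered_set k \<mu> r"
    using x(3) y(2) by (intro covered_set_limit[OF \<mu>, of "y \<circ> h" _ "\<lambda>n. 1 / real (Suc (h n))"]) auto
  then show "covered_set k \<mu> r \<inter> L \<noteq> {}"
    using x(1) by blast
qed

subsection \<open>Measurability of percolation\<close>

lemma space_config_space: "space (config_space :: 'a::euclidean_space measure measure) = counting_measures"
proof -
  have "Collect bBs \<noteq> ({} :: 'a set set)"
    using bBs_singleton by blast
  then show ?thesis
    by (auto simp: config_space_def space_Sup_eq_UN)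
qed

lemma measurable_emeasure_config_space:
  "bBs B \<Longrightarrow> (\<lambda>\<mu>. emeasure \<mu> B) \<in> borel_measurable config_space"
  unfolding config_space_def
  by (rule measurable_SUP1[of B]) (auto intro: measurable_vimage_algebra1)

lemma covered_set_misses_compact_measurable:
  assumes L: "compact L"
  shows "{\<mu> \<in> space config_space. covered_set k \<mu> r \<inter> L = {}} \<in> sets config_space"
proof -
  obtain D where D: "countable D" "D \<subseteq> L" "L \<subseteq> closure D"
    using separable by blast
  have [measurable]: "(\<lambda>\<mu>. emeasure \<mu> (cball y e)) \<in> borel_measurable config_space" for y :: 'a and e
    by (simp add: measurable_emeasure_config_space bBs_cball)
  have "{\<mu> \<in> space config_space. \<not> (\<forall>n. \<exists>y\<in>D. of_nat k \<le> emeasure \<mu> (cball y (r + 1 / real (Suc n))))}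
      \<in> sets config_space"
    using D(1) by measurable
  also have "{\<mu> \<in> space config_space. \<not> (\<forall>n. \<exists>y\<in>D. of_nat k \<le> emeasure \<mu> (cball y (r + 1 / real (Suc n))))}
      = {\<mu> \<in> space config_space. covered_set k \<mu> r \<inter> L = {}}"
    using covered_set_meets_compact_iff[OF _ L D(2,3)] unfolding space_config_space by blast
  finally show ?thesis .
qed

text \<open>By Sura-Bura, a component of a compact set has arbitrarily small clopen neighbourhoods.
  The component of a point of \<open>A\<close> misses \<open>B\<close>, hence so does a suitable
  clopen neighbourhood; finitely many of these cover \<open>K \<inter> A\<close> and form
  \<open>W\<close>.\<close>

lemma compact_separate_no_joining_component:
  fixes K :: "'a::euclidean_space set"
  assumes K: "compact K" and "closed A" "closed B"
    and no_join: "\<And>C. C \<subseteq> K \<Longrightarrow> connected C \<Longrightarrow> C \<inter> A = {} \<or> C \<inter> B = {}"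
  obtains W where "compact W" "compact (K - W)" "K \<inter> A \<subseteq> W" "W \<inter> B = {}"
proof -
  have "\<exists>U. open U \<and> x \<in> U \<and> compact (K \<inter> U) \<and> K \<inter> U \<inter> B = {}" if x: "x \<in> K \<inter> A" for x
  proof -
    define C where "C = connected_component_set K x"
    have xC: "x \<in> C" and CK: "C \<subseteq> K" and "connected C"
      using x by (auto simp: C_def connected_component_subset)
    then have "C \<inter> B = {}"
      using no_join[of C] x by blast
    have "C \<in> components K"
      using x by (auto simp: C_def components_def)
    moreover have "compact C"
      using K \<open>C \<in> components K\<close> by (rule compact_components)
    moreover have "open (- B)" "C \<subseteq> - B"
      using \<open>closed B\<close> \<open>C \<inter> B = {}\<close> by auto
    ultimately obtain W where W: "openin (top_of_set K) W" "compact W" "C \<subseteq> W" "W \<subseteq> - B"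
      using Sura_Bura_clopen_subset[OF closed_imp_locally_compact[OF compact_imp_closed[OF K]]] by metis
    then obtain U where "open U" "W = K \<inter> U"
      by (auto simp: openin_open)
    then show ?thesis
      using W xC by (intro exI[of _ U]) auto
  qed
  then obtain U where U: "\<And>x. x \<in> K \<inter> A \<Longrightarrow> open (U x) \<and> x \<in> U x \<and> compact (K \<inter> U x) \<and> K \<inter> U x \<inter> B = {}"
    by metis
  have "compact (K \<inter> A)"
    using K \<open>closed A\<close> by (rule compact_Int_closed)
  moreover have "K \<inter> A \<subseteq> (\<Union>x\<in>K \<inter> A. U x)"
    using U by auto
  ultimately obtain D where D: "D \<subseteq> K \<inter> A" "finite D" "K \<inter> A \<subseteq> (\<Union>x\<in>D. U x)"
    using U by (metis (no_types, lifting) compactE_image)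
  define W where "W = (\<Union>x\<in>D. K \<inter> U x)"
  have "compact W"
    using D U unfolding W_def by (intro compact_UN) auto
  moreover have "K - W = K \<inter> - (\<Union>x\<in>D. U x)"
    by (auto simp: W_def)
  moreover have "closed (- (\<Union>x\<in>D. U x))"
    using U D by (intro closed_Compl open_UN) auto
  then have "compact (K \<inter> - (\<Union>x\<in>D. U x))"
    using K by (rule compact_Int_closed[rotated])
  ultimately show ?thesis
    using that[of W] D U by (auto simp: W_def) blast+
qed

lemma compact_finite_basis_cover:
  assumes \<B>: "topological_basis \<B>" and "compact K" "open U" "K \<subseteq> U"
  obtains \<U> where "finite \<U>" "\<U> \<subseteq> \<B>" "K \<subseteq> \<Union>\<U>" "\<Union>\<U> \<subseteq> U"
proof -
  obtain \<V> where \<V>: "\<V> \<subseteq> \<B>" "\<Union>\<V> = U"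
    using \<B> \<open>open U\<close> unfolding topological_basis_def by blast
  then have "\<And>V. V \<in> \<V> \<Longrightarrow> open V"
    using \<B> topological_basis_open by blast
  then obtain \<U> where "\<U> \<subseteq> \<V>" "finite \<U>" "K \<subseteq> \<Union>\<U>"
    using \<V> \<open>compact K\<close> \<open>K \<subseteq> U\<close> by (meson compactE)
  then show ?thesis
    using \<V> that[of \<U>] by blast
qed

text \<open>Only countably many pairs \<open>\<U>, \<V>\<close> are involved when the basis is countable; this makes the
  percolation event measurable.\<close>

definition basis_separated :: "'a::real_normed_vector set set \<Rightarrow> 'a set \<Rightarrow> nat \<Rightarrow> nat \<Rightarrow> bool" where
  "basis_separated \<B> F m n \<longleftrightarrow>
     (\<exists>\<U>\<in>{\<U>. finite \<U> \<and> \<U> \<subseteq> \<B>}. \<exists>\<V>\<in>{\<V>. finite \<V> \<and> \<V> \<subseteq> \<B>}. \<Union>\<U> \<inter> \<Union>\<V> = {} \<and>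
        F \<inter> (cball 0 (real n) - (\<Union>\<U> \<union> \<Union>\<V>)) = {} \<and>
        F \<inter> (cball 0 (real m) - \<Union>\<U>) = {} \<and> F \<inter> (sphere 0 (real n) - \<Union>\<V>) = {})"

text \<open>Cutting the first union down to the open ball of radius \<open>n\<close> and adding the
  exterior of the closed ball to the second would disconnect \<open>T\<close>.\<close>

lemma unbounded_connected_not_basis_separated:
  assumes \<B>: "topological_basis \<B>" and "m \<le> n"
    and T: "connected T" "T \<subseteq> F" "\<not> bounded T" "T \<inter> cball 0 (real m) \<noteq> {}"
  shows "\<not> basis_separated \<B> F m n"
proof
  assume "basis_separated \<B> F m n"
  then obtain \<U> \<V> where UV: "\<U> \<subseteq> \<B>" "\<V> \<subseteq> \<B>" "\<Union>\<U> \<inter> \<Union>\<V> = {}"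
      "F \<inter> (cball 0 (real n) - (\<Union>\<U> \<union> \<Union>\<V>)) = {}"
      "F \<inter> (cball 0 (real m) - \<Union>\<U>) = {}" "F \<inter> (sphere 0 (real n) - \<Union>\<V>) = {}"
    unfolding basis_separated_def by blast
  have op: "open (\<Union>\<U>)" "open (\<Union>\<V>)"
    using UV(1,2) \<B> topological_basis_open by blast+
  define A1 where "A1 = \<Union>\<U> \<inter> ball 0 (real n)"
  define A2 where "A2 = \<Union>\<V> \<union> - cball 0 (real n)"
  have "open A1" "open A2"
    using op by (auto simp: A1_def A2_def open_Compl)
  moreover have "A1 \<inter> A2 \<inter> T = {}"
    using UV(3) by (auto simp: A1_def A2_def)
  moreover have "T \<subseteq> A1 \<union> A2"
  proof
    fix y assume "y \<in> T"
    then have "y \<in> F" using T(2) by blast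
    consider "norm y < n" | "norm y = n" | "norm y > n" by linarith
    then show "y \<in> A1 \<union> A2"
    proof cases
      case 1
      then have "y \<in> cball 0 (real n)" by simp
      with 1 show ?thesis using UV(4) \<open>y \<in> F\<close> by (auto simp: A1_def A2_def)
    next
      case 2
      then have "y \<in> sphere 0 (real n)" by simp
      then show ?thesis using UV(6) \<open>y \<in> F\<close> by (auto simp: A2_def)
    next
      case 3
      then show ?thesis by (simp add: A2_def)
    qed
  qed
  moreover have "A1 \<inter> T \<noteq> {}"
  proof -
    obtain y where y: "y \<in> T" "y \<in> cball 0 (real m)"
      using T(4) by blast
    then have "y \<in> \<Union>\<U>"
      using UV(5) T(2) by blast
    \<comment> \<open>Needed for \<open>m = n\<close>: a point of the sphere would lie in both
      unions.\<close>
    moreover have "norm y \<noteq> n"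
    proof
      assume "norm y = n"
      then have "y \<in> sphere 0 (real n)" by simp
      then have "y \<in> \<Union>\<V>"
        using UV(6) y(1) T(2) by blast
      with \<open>y \<in> \<Union>\<U>\<close> UV(3) show False by blast
    qed
    moreover have "norm y \<le> n"
      using y(2) \<open>m \<le> n\<close> by (simp add: order_trans)
    ultimately have "y \<in> A1"
      by (simp add: A1_def)
    then show ?thesis using y(1) by blast
  qed
  moreover have "A2 \<inter> T \<noteq> {}"
  proof -
    obtain y where "y \<in> T" "norm y > n"
      using T(3) unfolding bounded_iff by (meson not_le)
    then have "y \<in> A2 \<inter> T" by (simp add: A2_def)
    then show ?thesis by blast
  qed
  ultimately show False
    using T(1) unfolding connected_def by blast
qed

text \<open>Without a joining connected set, the part of \<open>F\<close> in the large ball splits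
  into two compact pieces. Normality gives them disjoint open neighbourhoods, and compactness
  shrinks these to finite unions of basic sets.\<close>

lemma not_basis_separated_joined:
  fixes F :: "'a::euclidean_space set"
  assumes \<B>: "topological_basis \<B>" and F: "closed F" and "m \<le> n"
    and ns: "\<not> basis_separated \<B> F m n"
  shows "\<exists>C. C \<subseteq> F \<and> connected C \<and> C \<inter> cball 0 (real m) \<noteq> {} \<and> C \<inter> sphere 0 (real n) \<noteq> {}"
proof (rule ccontr)
  assume no: "\<not> ?thesis"
  define K where "K = F \<inter> cball 0 (real n)"
  have K: "compact K"
    unfolding K_def using F by (simp add: closed_Int_compact)
  obtain W where W: "compact W" "compact (K - W)" "K \<inter> cball 0 (real m) \<subseteq> W" "W \<inter> sphere 0 (real n) = {}"
  proof (rule compact_separate_no_joining_component[OF K, of "cball 0 (real m)" "sphere 0 (real n)"])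
    show "C \<inter> cball 0 (real m) = {} \<or> C \<inter> sphere 0 (real n) = {}" if "C \<subseteq> K" "connected C" for C
      using no that by (auto simp: K_def)
  qed auto
  obtain U V where UV: "open U" "open V" "W \<subseteq> U" "K - W \<subseteq> V" "U \<inter> V = {}"
    using W(1,2) by (auto intro: separation_normal[of W "K - W"] dest: compact_imp_closed)
  obtain \<U> where \<U>: "finite \<U>" "\<U> \<subseteq> \<B>" "W \<subseteq> \<Union>\<U>" "\<Union>\<U> \<subseteq> U"
    using compact_finite_basis_cover[OF \<B> W(1) UV(1,3)] .
  obtain \<V> where \<V>: "finite \<V>" "\<V> \<subseteq> \<B>" "K - W \<subseteq> \<Union>\<V>" "\<Union>\<V> \<subseteq> V"
    using compact_finite_basis_cover[OF \<B> W(2) UV(2,4)] .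
  have mn: "cball 0 (real m) \<subseteq> cball (0::'a) (real n)"
    using \<open>m \<le> n\<close> by auto
  have sn: "sphere 0 (real n) \<subseteq> cball (0::'a) (real n)"
    by auto
  have "\<Union>\<U> \<inter> \<Union>\<V> = {}"
    using \<U>(4) \<V>(4) UV(5) by blast
  moreover have "F \<inter> (cball 0 (real n) - (\<Union>\<U> \<union> \<Union>\<V>)) = {}"
    using \<U>(3) \<V>(3) unfolding K_def by blast
  moreover have "F \<inter> (cball 0 (real m) - \<Union>\<U>) = {}"
    using \<U>(3) W(3) mn unfolding K_def by blast
  moreover have "F \<inter> (sphere 0 (real n) - \<Union>\<V>) = {}"
    using \<V>(3) W(4) sn unfolding K_def by blast
  ultimately have "basis_separated \<B> F m n"
    unfolding basis_separated_def using \<U>(1,2) \<V>(1,2) by blast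
  with ns show False ..
qed

text \<open>Points covered by the same atoms are joined by a segment in the covered set, so the covered
  set meets a ball in finitely many components; hence one component reaches arbitrarily far.\<close>

lemma percolatesI_joined:
  fixes \<mu> :: "'a::euclidean_space measure"
  assumes \<mu>: "\<mu> \<in> counting_measures"
    and joined: "\<And>n. n \<ge> m \<Longrightarrow> \<exists>C. C \<subseteq> covered_set k \<mu> r \<and> connected C \<and>
          C \<inter> cball 0 (real m) \<noteq> {} \<and> C \<inter> sphere 0 (real n) \<noteq> {}"
  shows "percolates (covered_set k \<mu> r)"
proof -
  let ?F = "covered_set k \<mu> r"
  obtain C where C: "\<And>n. n \<ge> m \<Longrightarrow> C n \<subseteq> ?F \<and> connected (C n) \<and>
          C n \<inter> cball 0 (real m) \<noteq> {} \<and> C n \<inter> sphere 0 (real n) \<noteq> {}"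
    using joined by metis
  have "\<exists>y w. y \<in> C n \<and> norm y \<le> m \<and> w \<in> C n \<and> norm w = n" if "n \<ge> m" for n
    using C[OF that] by auto
  then obtain y w where yw: "\<And>n. n \<ge> m \<Longrightarrow> y n \<in> C n \<and> norm (y n) \<le> m \<and> w n \<in> C n \<and> norm (w n) = n"
    by metis
  define A where "A = {x\<in>cball 0 (real m + r). emeasure \<mu> {x} > 0}"
  define S where "S n = {x\<in>cball (y n) r. emeasure \<mu> {x} > 0}" for n
  have fA: "finite A"
    unfolding A_def by (rule finite_counting_measure_atoms[OF \<mu> bBs_cball])
  have SA: "S n \<subseteq> A" if "n \<ge> m" for n
  proof
    fix x assume "x \<in> S n"
    then have "norm x \<le> m + r" "emeasure \<mu> {x} > 0"
      using yw[OF that] norm_triangle_ineq[of "y n" "x - y n"]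
      by (auto simp: S_def dist_norm norm_minus_commute)
    then show "x \<in> A" by (simp add: A_def)
  qed
  have "S ` {m..} \<subseteq> Pow A"
    using SA by auto
  then have "finite (S ` {m..})"
    using fA finite_subset by blast
  \<comment> \<open>Only finitely many sets of atoms are possible, so one of them recurs for
    infinitely many \<open>n\<close>; all the corresponding \<open>y n\<close> lie in one
    component.\<close>
  then obtain n0 where n0: "n0 \<ge> m" "infinite {n\<in>{m..}. S n = S n0}"
    using pigeonhole_infinite[of "{m..}" S] infinite_Ici by auto
  define T where "T = connected_component_set ?F (y n0)"
  have wT: "w n \<in> T" if n: "n \<ge> m" "S n = S n0" for n
  proof -
    have "closed_segment (y n0) (y n) \<subseteq> ?F"
    proof
      fix z assume z: "z \<in> closed_segment (y n0) (y n)"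
      have "S n0 \<subseteq> cball z r"
      proof
        fix x assume "x \<in> S n0"
        then have "y n0 \<in> cball x r" "y n \<in> cball x r"
          using n(2) by (auto simp: S_def dist_commute)
        then have "z \<in> cball x r"
          using z closed_segment_subset[OF _ _ convex_cball] by blast
        then show "x \<in> cball z r" by (simp add: dist_commute)
      qed
      have "of_nat k \<le> emeasure \<mu> (cball (y n0) r)"
        using C[OF n0(1)] yw[OF n0(1)] by (auto simp: covered_set_eq[OF \<mu>])
      also have "\<dots> = (\<Sum>x\<in>S n0. emeasure \<mu> {x})"
        unfolding S_def by (rule counting_measure_eq_sum_atoms[OF \<mu> bBs_cball])
      also have "\<dots> = emeasure \<mu> (S n0)"
        using finite_subset[OF SA[OF n0(1)] fA] counting_measuresD(1)[OF \<mu>]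
        by (subst emeasure_eq_sum_singleton) auto
      also have "\<dots> \<le> emeasure \<mu> (cball z r)"
        using \<open>S n0 \<subseteq> cball z r\<close> counting_measuresD(1)[OF \<mu>] by (intro emeasure_mono) auto
      finally show "z \<in> ?F"
        by (simp add: covered_set_eq[OF \<mu>])
    qed
    then have "connected_component ?F (y n0) (y n)"
      unfolding connected_component_def by (intro exI[of _ "closed_segment (y n0) (y n)"]) auto
    moreover have "connected_component ?F (y n) (w n)"
      unfolding connected_component_def using C[OF n(1)] yw[OF n(1)] by blast
    ultimately show ?thesis
      unfolding T_def by (auto intro: connected_component_trans)
  qed
  have "\<not> bounded T"
  proof
    assume "bounded T"
    then obtain b where b: "\<And>x. x \<in> T \<Longrightarrow> norm x \<le> b"
      unfolding bounded_iff by blast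
    obtain N :: nat where "b < N" using reals_Archimedean2 by blast
    obtain n where "n > N" "n \<ge> m" "S n = S n0"
      using n0(2) unfolding infinite_nat_iff_unbounded by auto
    then show False
      using b[OF wT[of n]] yw[of n] \<open>b < N\<close> by simp
  qed
  then show ?thesis
    unfolding percolates_def T_def
    by (intro exI[of _ "connected_component_set ?F (y n0)"]) (simp add: connected_component_subset)
qed

lemma percolates_covered_set_iff:
  fixes \<mu> :: "'a::euclidean_space measure"
  assumes \<mu>: "\<mu> \<in> counting_measures" and \<B>: "topological_basis \<B>"
  shows "percolates (covered_set k \<mu> r) \<longleftrightarrow> (\<exists>m. \<forall>n\<in>{m..}. \<not> basis_separated \<B> (covered_set k \<mu> r) m n)"
proof
  assume "percolates (covered_set k \<mu> r)"
  then obtain T where T: "T \<subseteq> covered_set k \<mu> r" "connected T" "\<not> bounded T"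
    unfolding percolates_def by blast
  then obtain x where "x \<in> T"
    by (metis bounded_empty ex_in_conv)
  obtain m :: nat where "norm x \<le> m"
    using real_arch_simple by blast
  then have "T \<inter> cball 0 (real m) \<noteq> {}"
    using \<open>x \<in> T\<close> by auto
  then show "\<exists>m. \<forall>n\<in>{m..}. \<not> basis_separated \<B> (covered_set k \<mu> r) m n"
    using unbounded_connected_not_basis_separated[OF \<B> _ T(2,1,3)] by (intro exI[of _ m] ballI) auto
next
  assume "\<exists>m. \<forall>n\<in>{m..}. \<not> basis_separated \<B> (covered_set k \<mu> r) m n"
  then obtain m where "\<And>n. n \<ge> m \<Longrightarrow> \<not> basis_separated \<B> (covered_set k \<mu> r) m n"
    by auto
  then show "percolates (covered_set k \<mu> r)"
    using percolatesI_joined[OF \<mu>] not_basis_separated_joined[OF \<B> closed_covered_set[OF \<mu>]] by meson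
qed

text \<open>Apart from disjointness of the two unions, which does not involve \<open>\<mu>\<close>,
  every clause of \<open>basis_separated\<close> says that the covered set misses a compact set,
  namely a ball or sphere minus an open set. All quantifiers range over countable sets.\<close>

lemma percolation_event_measurable:
  "{\<mu> \<in> space config_space. percolates (covered_set k \<mu> r :: 'a::euclidean_space set)} \<in> sets config_space"
proof -
  obtain \<B> :: "'a set set" where \<B>: "countable \<B>" "topological_basis \<B>"
    using ex_countable_basis by blast
  let ?M = "config_space :: 'a measure measure"
  have cnt: "countable {\<U>. finite \<U> \<and> \<U> \<subseteq> \<B>}"
    using \<B>(1) by (rule countable_Collect_finite_subset)
  have op: "open (\<Union>\<U>)" if "\<U> \<in> {\<U>. finite \<U> \<and> \<U> \<subseteq> \<B>}" for \<U>
    using that \<B>(2) topological_basis_open by blast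
  have "{\<mu> \<in> space ?M. basis_separated \<B> (covered_set k \<mu> r) m n} \<in> sets ?M" for m n
    unfolding basis_separated_def
    by (intro sets.sets_Collect_countable_Ex'[OF _ cnt] sets.sets_Collect_conj sets.sets_Collect_const
        covered_set_misses_compact_measurable compact_diff open_Un op compact_cball compact_sphere)
  then have "{\<mu> \<in> space ?M. \<exists>m. \<forall>n\<in>{m..}. \<not> basis_separated \<B> (covered_set k \<mu> r) m n} \<in> sets ?M"
    by (intro sets.sets_Collect_countable_Ex sets.sets_Collect_countable_Ball sets.sets_Collect_neg)
  also have "{\<mu> \<in> space ?M. \<exists>m. \<forall>n\<in>{m..}. \<not> basis_separated \<B> (covered_set k \<mu> r) m n} =
      {\<mu> \<in> space ?M. percolates (covered_set k \<mu> r)}"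
    using percolates_covered_set_iff[OF _ \<B>(2)] by (auto simp: space_config_space)
  finally show ?thesis .
qed

subsection \<open>Lattice cells and walks\<close>

text \<open>Rounding yields half-open cubes that partition space, so distinct cells are exactly
  disjoint, as \<alpha>-weak sub-Poissonianity demands.\<close>

definition cell :: "real \<Rightarrow> int ^ 'd \<Rightarrow> (real ^ 'd) set" where
  "cell s z = {x. \<forall>i. round (x $ i / s) = z $ i}"

text \<open>For \<open>t = s / 2\<close> this is the closed cell; larger \<open>t\<close> thickens
  it. The closed version serves the topological arguments.\<close>

definition grid_box :: "real \<Rightarrow> real \<Rightarrow> int ^ 'd \<Rightarrow> (real ^ 'd) set" where
  "grid_box s t z = {x. \<forall>i. \<bar>x $ i - s * of_int (z $ i)\<bar> \<le> t}"

text \<open>Each cell is adjacent to itself. This only enlarges the count of walks; self-avoidance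
  is imposed separately by \<open>distinct\<close>.\<close>

definition adjacent :: "int ^ 'd \<Rightarrow> int ^ 'd \<Rightarrow> bool" where
  "adjacent z w \<longleftrightarrow> (\<forall>i. \<bar>z $ i - w $ i\<bar> \<le> 1)"

lemma cell_subset_grid_box:
  fixes z :: "int ^ 'd"
  assumes "s > 0"
  shows "cell s z \<subseteq> grid_box s (s / 2) z"
proof -
  have "\<bar>a - s * of_int (round (a / s))\<bar> \<le> s / 2" for a :: real
  proof -
    have "a - s * of_int (round (a / s)) = - (s * (of_int (round (a / s)) - a / s))"
      using assms by (simp add: right_diff_distrib)
    then have "\<bar>a - s * of_int (round (a / s))\<bar> = s * \<bar>of_int (round (a / s)) - a / s\<bar>"
      using assms by (simp add: abs_mult)
    also have "\<dots> \<le> s * (1 / 2)"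
      using assms by (intro mult_left_mono of_int_round_abs_le) auto
    finally show ?thesis by simp
  qed
  note bound = this
  show ?thesis
  proof
    fix x assume "x \<in> cell s z"
    then have "round (x $ i / s) = z $ i" for i
      by (simp add: cell_def)
    then show "x \<in> grid_box s (s / 2) z"
      using bound[of "x $ i" for i] by (simp add: grid_box_def)
  qed
qed

lemma in_cell_iff: "x \<in> cell s z \<longleftrightarrow> z = (\<chi> i. round (x $ i / s))"
  by (auto simp: cell_def vec_eq_iff)

lemma disjoint_cell: "disjoint_family_on (cell s) A"
  by (auto simp: disjoint_family_on_def in_cell_iff)

lemma grid_box_eq_cbox:
  "grid_box s t z = cbox (\<chi> i. s * of_int (z $ i) - t) (\<chi> i. s * of_int (z $ i) + t)"
  by (auto simp: grid_box_def mem_box_cart abs_le_iff algebra_simps)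

lemma closed_grid_box: "closed (grid_box s t z)"
  by (simp add: grid_box_eq_cbox closed_cbox)

lemma bBs_cell:
  assumes "s > 0"
  shows "bBs (cell s z)"
proof -
  have "cell s z = (\<Inter>i. (\<lambda>x. round (x $ i / s)) -` {z $ i} \<inter> space borel)"
    by (auto simp: cell_def)
  also have "\<dots> \<in> sets borel"
    by (intro sets.finite_INT measurable_sets[of _ _ "count_space UNIV"]) (auto simp: round_def)
  finally have "cell s z \<in> sets borel" .
  moreover have "bounded (cell s z)"
    using cell_subset_grid_box[OF assms] bounded_cbox unfolding grid_box_eq_cbox
    by (rule bounded_subset[rotated])
  ultimately show ?thesis
    by (simp add: bBs_def)
qed

text \<open>Which faces belong to a cell depends on the rounding convention, so the volume is
  squeezed between those of the open and the closed box.\<close>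

lemma emeasure_cell:
  fixes z :: "int ^ 'd"
  assumes "s > 0"
  shows "emeasure lborel (cell s z) = ennreal (s ^ CARD('d))"
proof -
  define a b :: "real ^ 'd" where "a = (\<chi> i. s * of_int (z $ i) - s / 2)"
    and "b = (\<chi> i. s * of_int (z $ i) + s / 2)"
  have "measure lborel (cbox a b) = (\<Prod>i\<in>UNIV. b $ i - a $ i)"
    using assms by (intro content_cbox_cart) (auto simp: a_def b_def interval_ne_empty_cart)
  also have "\<dots> = s ^ CARD('d)"
    by (simp add: a_def b_def)
  finally have cb: "emeasure lborel (cbox a b) = ennreal (s ^ CARD('d))"
    using emeasure_eq_ennreal_measure[of lborel "cbox a b"] emeasure_lborel_cbox_finite[of a b] by simp
  have ord: "a \<bullet> i \<le> b \<bullet> i" if "i \<in> Basis" for i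
    using that assms by (auto simp: a_def b_def Basis_vec_def inner_axis)
  have bx: "emeasure lborel (box a b) = ennreal (s ^ CARD('d))"
    using ord by (subst cb[symmetric], subst emeasure_lborel_cbox, simp, subst emeasure_lborel_box) auto
  have "round (u / s) = v" if "s * of_int v - s / 2 < u" "u < s * of_int v + s / 2" for u :: real and v :: int
    using that assms by (intro round_unique) (simp_all add: field_simps)
  then have "box a b \<subseteq> cell s z"
    by (auto simp: cell_def a_def b_def mem_box_cart)
  then have "emeasure lborel (box a b) \<le> emeasure lborel (cell s z)"
    using bBs_cell[OF assms] by (intro emeasure_mono) (auto simp: bBs_def)
  moreover have "emeasure lborel (cell s z) \<le> emeasure lborel (cbox a b)"
    using cell_subset_grid_box[OF assms, of z] by (intro emeasure_mono) (auto simp: grid_box_eq_cbox a_def b_def)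
  ultimately show ?thesis
    using cb bx by simp
qed

lemma finite_vec_bounded:
  assumes "\<And>i. finite (S i)"
  shows "finite {z :: 'a ^ 'd. \<forall>i. z $ i \<in> S i}"
proof (rule finite_imageD[of vec_nth])
  have "vec_nth ` {z :: 'a ^ 'd. \<forall>i. z $ i \<in> S i} \<subseteq> PiE UNIV S"
    by auto
  then show "finite (vec_nth ` {z :: 'a ^ 'd. \<forall>i. z $ i \<in> S i})"
    using finite_PiE[of UNIV S] assms finite_subset by auto
  show "inj_on vec_nth {z :: 'a ^ 'd. \<forall>i. z $ i \<in> S i}"
    by (simp add: inj_on_def vec_nth_inject)
qed

lemma finite_grid_box_meets_ball:
  fixes x :: "real ^ 'd"
  assumes "s > 0"
  shows "finite {z. grid_box s t z \<inter> ball x r \<noteq> {}}"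
proof -
  have "{z. grid_box s t z \<inter> ball x r \<noteq> {}} \<subseteq> {z. \<forall>i. z $ i \<in> {\<lfloor>(x $ i - r - t) / s\<rfloor>..\<lceil>(x $ i + r + t) / s\<rceil>}}"
  proof (intro subsetI CollectI allI)
    fix z i assume "z \<in> {z. grid_box s t z \<inter> ball x r \<noteq> {}}"
    then obtain y where y: "y \<in> grid_box s t z" "dist x y < r"
      by auto
    have "\<bar>x $ i - y $ i\<bar> < r"
      using dist_vec_nth_le[of x i y] y(2) by (simp add: dist_real_def)
    moreover have "\<bar>y $ i - s * of_int (z $ i)\<bar> \<le> t"
      using y(1) by (simp add: grid_box_def)
    ultimately have "x $ i - r - t \<le> of_int (z $ i) * s" "of_int (z $ i) * s \<le> x $ i + r + t"
      by (auto simp: abs_le_iff abs_less_iff mult.commute)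
    then have "(x $ i - r - t) / s \<le> of_int (z $ i)" "of_int (z $ i) \<le> (x $ i + r + t) / s"
      using assms by (auto simp: field_simps)
    then show "z $ i \<in> {\<lfloor>(x $ i - r - t) / s\<rfloor>..\<lceil>(x $ i + r + t) / s\<rceil>}"
      by (auto simp: floor_le_iff le_ceiling_iff)
  qed
  then show ?thesis
    by (rule finite_subset) (intro finite_vec_bounded finite_atLeastAtMost_int)
qed

text \<open>The index set may be infinite, but the family is locally finite.\<close>

lemma closed_Union_grid_box:
  fixes Z :: "(int ^ 'd) set"
  assumes "s > 0"
  shows "closed (\<Union>z\<in>Z. grid_box s t z)"
proof -
  have "locally_finite_in euclidean (grid_box s t ` Z)"
    unfolding locally_finite_in_def
  proof (intro conjI ballI)
    fix x :: "real ^ 'd"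
    have "{U \<in> grid_box s t ` Z. U \<inter> ball x 1 \<noteq> {}} \<subseteq> grid_box s t ` {z. grid_box s t z \<inter> ball x 1 \<noteq> {}}"
      by auto
    then have "finite {U \<in> grid_box s t ` Z. U \<inter> ball x 1 \<noteq> {}}"
      using finite_grid_box_meets_ball[OF assms] finite_subset by blast
    then show "\<exists>V. openin euclidean V \<and> x \<in> V \<and> finite {U \<in> grid_box s t ` Z. U \<inter> V \<noteq> {}}"
      by (intro exI[of _ "ball x 1"]) auto
  qed auto
  then have "closedin euclidean (\<Union>(grid_box s t ` Z))"
    by (rule closedin_locally_finite_Union[rotated]) (auto simp: closed_grid_box)
  then show ?thesis by simp
qed

text \<open>A common point puts the centres at coordinate distance at most
  \<open>2 * t < 2 * s\<close>, so the integer indices differ by less than 2.\<close>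

lemma grid_boxes_meet_adjacent:
  assumes "t < s" "x \<in> grid_box s t z" "x \<in> grid_box s t w"
  shows "adjacent z w"
  unfolding adjacent_def
proof
  fix i
  have "\<bar>x $ i - s * of_int (z $ i)\<bar> \<le> t" "\<bar>x $ i - s * of_int (w $ i)\<bar> \<le> t"
    using assms by (auto simp: grid_box_def)
  then have "\<bar>s * of_int (z $ i) - s * of_int (w $ i)\<bar> < s * 2" "s > 0"
    using \<open>t < s\<close> by (auto simp: abs_le_iff abs_less_iff)
  moreover have "\<bar>s * of_int (z $ i) - s * of_int (w $ i)\<bar> = s * \<bar>of_int (z $ i - w $ i)\<bar>"
    using \<open>s > 0\<close> by (simp add: abs_mult flip: right_diff_distrib)
  ultimately have "s * \<bar>of_int (z $ i - w $ i)\<bar> < s * 2"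
    by simp
  then have "\<bar>of_int (z $ i - w $ i) :: real\<bar> < 2"
    using \<open>s > 0\<close> by (simp only: mult_less_cancel_left_pos)
  then show "\<bar>z $ i - w $ i\<bar> \<le> 1"
    by linarith
qed

text \<open>The boxes of reachable cells and those of the remaining cells of \<open>Z\<close> have
  closed unions, disjoint because boxes that meet are adjacent. Connectedness keeps \<open>T\<close>
  inside the first union.\<close>

lemma connected_cover_grid_boxes_reach:
  assumes "t < s" "s > 0" and T: "connected T" "T \<subseteq> (\<Union>z\<in>Z. grid_box s t z)"
    and a: "a \<in> Z" "T \<inter> grid_box s t a \<noteq> {}" and b: "b \<in> Z" "T \<inter> grid_box s t b \<noteq> {}"
  shows "(\<lambda>z w. adjacent z w \<and> w \<in> Z)\<^sup>*\<^sup>* a b"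
proof -
  define A where "A = {b \<in> Z. (\<lambda>z w. adjacent z w \<and> w \<in> Z)\<^sup>*\<^sup>* a b}"
  let ?U1 = "\<Union>z\<in>A. grid_box s t z" and ?U2 = "\<Union>z\<in>Z - A. grid_box s t z"
  have "a \<in> A"
    using a by (simp add: A_def)
  have "w \<in> A" if "z \<in> A" "w \<in> Z" "adjacent z w" for z w
    using that by (auto simp: A_def intro: rtranclp.rtrancl_into_rtrancl)
  then have "?U1 \<inter> ?U2 = {}"
    using grid_boxes_meet_adjacent[OF \<open>t < s\<close>] by blast
  moreover have "closed ?U1" "closed ?U2"
    using \<open>s > 0\<close> by (simp_all add: closed_Union_grid_box)
  moreover have "T \<subseteq> ?U1 \<union> ?U2" "?U1 \<inter> T \<noteq> {}"
    using T(2) a(2) \<open>a \<in> A\<close> by blast+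
  ultimately have "?U2 \<inter> T = {}"
    using T(1) unfolding connected_closed by blast
  then have "b \<in> A"
    using b by blast
  then show ?thesis
    by (simp add: A_def)
qed

section \<open>Self-avoiding walks of cells: counting and existence\<close>

fun walks :: "nat \<Rightarrow> int ^ 'd \<Rightarrow> (int ^ 'd) list set" where
  "walks 0 a = {[a]}"
| "walks (Suc n) a = (\<Union>b\<in>{b. adjacent a b}. (#) a ` walks n b)"

lemma length_walks: "zs \<in> walks n a \<Longrightarrow> length zs = Suc n"
proof (induction n arbitrary: a zs)
  case (Suc n)
  then obtain b ys where "zs = a # ys" "ys \<in> walks n b"
    by auto
  then show ?case using Suc.IH by simp
qed simp

lemma finite_adjacent: "finite {b. adjacent a b}"
proof -
  have "{b. adjacent a b} = {b. \<forall>i. b $ i \<in> {a $ i - 1..a $ i + 1}}"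
    by (auto simp: adjacent_def abs_le_iff algebra_simps)
  also have "finite \<dots>"
    by (intro finite_vec_bounded) simp
  finally show ?thesis .
qed

lemma card_adjacent: "card {b. adjacent (a :: int ^ 'd) b} = card {b :: int ^ 'd. adjacent 0 b}"
proof (rule bij_betw_same_card)
  show "bij_betw (\<lambda>b. b - a) {b. adjacent a b} {b. adjacent 0 b}"
    by (rule bij_betwI[of _ _ _ "\<lambda>b. b + a"]) (auto simp: adjacent_def abs_minus_commute)
qed

lemma finite_walks: "finite (walks n a)"
  by (induction n arbitrary: a) (auto intro: finite_adjacent)

lemma card_walks_le: "card (walks n (a :: int ^ 'd)) \<le> card {b :: int ^ 'd. adjacent 0 b} ^ n"
proof (induction n arbitrary: a)
  case (Suc n)
  have "card (walks (Suc n) a) \<le> (\<Sum>b | adjacent a b. card ((#) a ` walks n b))"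
    by (simp add: card_UN_le finite_adjacent)
  also have "\<dots> \<le> (\<Sum>b | adjacent a b. card {b :: int ^ 'd. adjacent 0 b} ^ n)"
    by (intro sum_mono order_trans[OF card_image_le[OF finite_walks] Suc])
  also have "\<dots> = card {b :: int ^ 'd. adjacent 0 b} ^ Suc n"
    by (simp add: card_adjacent[of a])
  finally show ?case .
qed simp

lemma walks_of_rtrancl_path:
  assumes "rtrancl_path (\<lambda>z w. adjacent z w \<and> w \<in> Z) a xs b"
  shows "n \<le> length xs \<Longrightarrow> a # take n xs \<in> walks n a"
  using assms
proof (induction arbitrary: n)
  case (step x y ys z)
  then show ?case by (cases n) auto
qed auto

lemma rtrancl_path_subset:
  assumes "rtrancl_path (\<lambda>z w. adjacent z w \<and> w \<in> Z) a xs b"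
  shows "set xs \<subseteq> Z"
  using assms by induction auto

lemma rtrancl_path_length_ge:
  assumes "rtrancl_path (\<lambda>z w. adjacent z w \<and> w \<in> Z) a xs b"
  shows "\<bar>b $ i - a $ i\<bar> \<le> int (length xs)"
  using assms
proof induction
  case (step x y ys z)
  have "\<bar>x $ i - y $ i\<bar> \<le> 1"
    using step(1) by (simp add: adjacent_def)
  then show ?case using step(3) by simp
qed auto

text \<open>A path from \<open>a\<close> to \<open>b\<close>, freed of repetitions, still has at
  least \<open>n\<close> steps, as each step changes coordinate \<open>i\<close> by at most 1. Its
  first \<open>n\<close> steps form the walk.\<close>

lemma connected_cover_grid_boxes_walk:
  assumes "t < s" "s > 0" and T: "connected T" "T \<subseteq> (\<Union>z\<in>Z. grid_box s t z)"
    and a: "a \<in> Z" "T \<inter> grid_box s t a \<noteq> {}" and b: "b \<in> Z" "T \<inter> grid_box s t b \<noteq> {}"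
    and far: "int n \<le> \<bar>b $ i - a $ i\<bar>"
  shows "\<exists>zs\<in>walks n a. distinct zs \<and> set zs \<subseteq> Z"
proof -
  obtain xs where xs: "rtrancl_path (\<lambda>z w. adjacent z w \<and> w \<in> Z) a xs b"
    using connected_cover_grid_boxes_reach[OF assms(1-8)] unfolding rtranclp_eq_rtrancl_path by blast
  obtain ys where ys: "rtrancl_path (\<lambda>z w. adjacent z w \<and> w \<in> Z) a ys b" "distinct (a # ys)"
    using rtrancl_path_distinct[OF xs] by blast
  have "n \<le> length ys"
    using rtrancl_path_length_ge[OF ys(1), of i] far by simp
  then have "a # take n ys \<in> walks n a"
    by (rule walks_of_rtrancl_path[OF ys(1)])
  moreover have "distinct (a # take n ys)" "set (a # take n ys) \<subseteq> Z"
    using ys(2) rtrancl_path_subset[OF ys(1)] a(1) by (auto dest: in_set_takeD)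
  ultimately show ?thesis by blast
qed

lemma point_process_space: "point_process P \<Longrightarrow> space P = counting_measures"
  unfolding point_process_def using sets_eq_imp_space_eq space_config_space by blast

lemma point_process_measurable_emeasure:
  "point_process P \<Longrightarrow> bBs B \<Longrightarrow> (\<lambda>\<mu>. emeasure \<mu> B) \<in> borel_measurable P"
  unfolding point_process_def
  using measurable_emeasure_config_space[of B] measurable_cong_sets[of P config_space borel "borel :: ennreal measure"] by simp

lemma one_le_card_adjacent: "1 \<le> card {b :: int ^ 'd. adjacent 0 b}"
proof -
  have "{b :: int ^ 'd. adjacent 0 b} \<noteq> {}"
    by (auto simp: adjacent_def intro!: exI[of _ 0])
  then show ?thesis
    using finite_adjacent[of "0 :: int ^ 'd"] by (simp add: Suc_le_eq card_gt_0_iff)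
qed

subsection \<open>The lower bound\<close>

text \<open>The thickened occupied cells cover an unbounded connected set. Since this set leaves
  every finite neighbourhood of a cell that it meets, walks of all lengths start from one and the
  same cell.\<close>

lemma percolates_imp_occupied_walks:
  fixes \<mu> :: "(real ^ 'd) measure"
  assumes \<mu>: "\<mu> \<in> counting_measures" and s: "s > 0" and r: "0 \<le> r" "r < s / 2"
    and perc: "percolates (covered_set 1 \<mu> r)"
  shows "\<exists>a. \<forall>n. \<exists>zs\<in>walks n a. distinct zs \<and> (\<forall>z\<in>set zs. 1 \<le> emeasure \<mu> (cell s z))"
proof -
  obtain T where T: "T \<subseteq> covered_set 1 \<mu> r" "connected T" "\<not> bounded T"
    using perc by (auto simp: percolates_def)
  define Z where "Z = {z. emeasure \<mu> (cell s z) \<ge> 1}"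
  \<comment> \<open>The box of this half-side contains every point within distance \<open>r\<close>
    of the cell, and \<open>r < s / 2\<close> keeps it below \<open>s\<close>, so that boxes that
    meet are adjacent.\<close>
  define t where "t = s / 2 + r"
  have "\<exists>z\<in>Z. y \<in> grid_box s t z" if y: "y \<in> T" for y
  proof -
    have "1 \<le> emeasure \<mu> (cball y r)"
      using y T(1) by (auto simp: covered_set_eq[OF \<mu>])
    then have "0 < emeasure \<mu> (cball y r)"
      using less_le_trans zero_less_one by blast
    then obtain x where x: "x \<in> cball y r" "0 < emeasure \<mu> {x}"
      using counting_measure_atom_exists[OF \<mu> bBs_cball] by blast
    define z where "z = (\<chi> i. round (x $ i / s))"
    have xz: "x \<in> cell s z"
      by (simp add: in_cell_iff z_def)
    have "emeasure \<mu> {x} \<le> emeasure \<mu> (cell s z)"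
      using xz bBs_cell[OF s] counting_measuresD(1)[OF \<mu>] by (intro emeasure_mono) (auto simp: bBs_def)
    then have "z \<in> Z"
      using x(2) counting_measure_zero_or_ge_1[OF \<mu> bBs_cell[OF s], of z] by (auto simp: Z_def)
    moreover have "\<bar>y $ i - s * of_int (z $ i)\<bar> \<le> t" for i
    proof -
      have "\<bar>y $ i - x $ i\<bar> \<le> r"
        using dist_vec_nth_le[of y i x] x(1) by (simp add: dist_real_def)
      moreover have "\<bar>x $ i - s * of_int (z $ i)\<bar> \<le> s / 2"
        using cell_subset_grid_box[OF s, of z] xz by (auto simp: grid_box_def)
      ultimately show ?thesis
        unfolding t_def by linarith
    qed
    ultimately show ?thesis
      by (auto simp: grid_box_def)
  qed
  then have cover: "T \<subseteq> (\<Union>z\<in>Z. grid_box s t z)"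
    by blast
  obtain p where "p \<in> T"
    using T(3) by (metis bounded_empty ex_in_conv)
  then obtain a where a: "a \<in> Z" "T \<inter> grid_box s t a \<noteq> {}"
    using cover by blast
  have "\<exists>zs\<in>walks n a. distinct zs \<and> set zs \<subseteq> Z" for n
  proof -
    \<comment> \<open>The finitely many cells whose coordinates differ from those of
      \<open>a\<close> by at most \<open>n\<close>; \<open>T\<close> is unbounded and must meet the
      box of a cell of \<open>Z\<close> outside them.\<close>
    let ?N = "{b. \<forall>i. b $ i \<in> {a $ i - int n..a $ i + int n}}"
    have "finite ?N"
      by (intro finite_vec_bounded) simp
    then have "bounded (\<Union>b\<in>?N. grid_box s t b)"
      by (intro bounded_UN ballI) (simp_all add: grid_box_eq_cbox bounded_cbox)
    then have "\<not> T \<subseteq> (\<Union>b\<in>?N. grid_box s t b)"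
      using T(3) bounded_subset by blast
    then obtain b where b: "b \<in> Z" "T \<inter> grid_box s t b \<noteq> {}" "b \<notin> ?N"
      using cover by blast
    then obtain i where "\<not> (b $ i \<in> {a $ i - int n..a $ i + int n})"
      by blast
    then have "int n \<le> \<bar>b $ i - a $ i\<bar>"
      by auto
    moreover have "t < s"
      using r by (simp add: t_def)
    ultimately show ?thesis
      using connected_cover_grid_boxes_walk[OF _ s T(2) cover a b(1,2)] by blast
  qed
  then show ?thesis
    unfolding Z_def by blast
qed

text \<open>A first-moment bound: if all the cells are occupied, the product of their counts is at
  least 1, so the expectation of the product bounds the probability.\<close>

lemma occupied_cells_prob_le:
  fixes P :: "(real ^ 'd) measure measure"
  assumes P: "point_process P" "has_intensity P l" "alpha_weakly_sub_Poisson P" and s: "s > 0"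
    and zs: "distinct zs" "zs \<noteq> []"
  shows "emeasure P {\<mu> \<in> space P. \<forall>z\<in>set zs. 1 \<le> emeasure \<mu> (cell s z)}
    \<le> ennreal ((l * s ^ CARD('d)) ^ length zs)"
proof -
  define n where "n = length zs"
  \<comment> \<open>List positions start at 0, the family in \<open>alpha_weakly_sub_Poisson\<close>
    at 1.\<close>
  define B where "B i = cell s (zs ! (i - 1))" for i
  have "l > 0"
    using P(2) by (simp add: has_intensity_def)
  have n: "1 \<le> n"
    using zs(2) by (cases zs) (auto simp: n_def)
  have bB: "bBs (B i)" for i
    using s by (simp add: B_def bBs_cell)
  have mB[measurable]: "(\<lambda>\<mu>. emeasure \<mu> (B i)) \<in> borel_measurable P" for i
    by (rule point_process_measurable_emeasure[OF P(1) bB])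
  have disj: "disjoint_family_on B {1..n}"
    unfolding disjoint_family_on_def B_def
  proof (intro ballI impI)
    fix i j assume "i \<in> {1..n}" "j \<in> {1..n}" "i \<noteq> j"
    then have "zs ! (i - 1) \<noteq> zs ! (j - 1)"
      using zs(1) by (subst nth_eq_iff_index_eq) (auto simp: n_def)
    then show "cell s (zs ! (i - 1)) \<inter> cell s (zs ! (j - 1)) = {}"
      using disjoint_cell[of s UNIV] unfolding disjoint_family_on_def by blast
  qed
  let ?E = "{\<mu> \<in> space P. \<forall>i\<in>{1..n}. 1 \<le> emeasure \<mu> (B i)}"
  have E_eq: "{\<mu> \<in> space P. \<forall>z\<in>set zs. 1 \<le> emeasure \<mu> (cell s z)} = ?E"
  proof -
    have "set zs = (\<lambda>i. zs ! (i - 1)) ` {1..n}"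
      unfolding set_conv_nth n_def by (force simp: image_iff intro: bexI[of _ "Suc _"])
    then show ?thesis
      by (simp add: B_def)
  qed
  have "emeasure P ?E = (\<integral>\<^sup>+ \<mu>. indicator ?E \<mu> \<partial>P)"
    by (subst nn_integral_indicator) measurable
  also have "\<dots> \<le> (\<integral>\<^sup>+ \<mu>. (\<Prod>i = 1..n. emeasure \<mu> (B i)) \<partial>P)"
  proof (intro nn_integral_mono)
    fix \<mu>
    show "indicator ?E \<mu> \<le> (\<Prod>i = 1..n. emeasure \<mu> (B i))"
      by (auto simp: indicator_def intro!: prod_ge_1)
  qed
  also have "\<dots> \<le> (\<Prod>i = 1..n. mean_count P (B i))"
    using P(3) n bB disj unfolding alpha_weakly_sub_Poisson_def by blast
  also have "\<dots> = (\<Prod>i = 1..n. ennreal (l * s ^ CARD('d)))"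
  proof (rule prod.cong)
    fix i
    have "mean_count P (B i) = ennreal l * emeasure lborel (B i)"
      using P(2) bB[of i] by (simp add: has_intensity_def bBs_def)
    then show "mean_count P (B i) = ennreal (l * s ^ CARD('d))"
      using s \<open>l > 0\<close> by (simp add: B_def emeasure_cell ennreal_mult)
  qed simp
  also have "\<dots> = ennreal ((l * s ^ CARD('d)) ^ n)"
    using s \<open>l > 0\<close> by (simp add: ennreal_power)
  finally show ?thesis
    unfolding E_eq by (simp add: n_def)
qed

text \<open>For a fixed starting cell, the union bound over self-avoiding walks of \<open>n\<close>
  steps decays geometrically in \<open>n\<close>, so occupied walks of all lengths have probability
  0. There are only countably many starting cells.\<close>

lemma no_percolation_small_radius:
  fixes P :: "(real ^ 'd) measure measure" and s :: real
  assumes P: "point_process P" "has_intensity P l" "alpha_weakly_sub_Poisson P" and s: "s > 0"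
    and small: "card {b :: int ^ 'd. adjacent 0 b} * (l * s ^ CARD('d)) \<le> 1 / 2"
    and r: "0 \<le> r" "r < s / 2"
  shows "measure P {\<mu> \<in> space P. percolates (covered_set 1 \<mu> r)} = 0"
proof -
  interpret prob_space P
    using P(1) by (simp add: point_process_def)
  define M where "M = card {b :: int ^ 'd. adjacent 0 b}"
  define q where "q = l * s ^ CARD('d)"
  have q: "0 \<le> q" "real M * q \<le> 1 / 2"
    using P(2) s small by (auto simp: has_intensity_def q_def M_def)
  define E where "E n a = (\<Union>zs\<in>{zs \<in> walks n a. distinct zs}.
      {\<mu> \<in> space P. \<forall>z\<in>set zs. 1 \<le> emeasure \<mu> (cell s z)})" for n and a :: "int ^ 'd"
  have [measurable]: "(\<lambda>\<mu>. emeasure \<mu> (cell s z)) \<in> borel_measurable P" for z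
    by (rule point_process_measurable_emeasure[OF P(1) bBs_cell[OF s]])
  have fin: "finite {zs \<in> walks n a. distinct zs}" for n and a :: "int ^ 'd"
    by (simp add: finite_walks)
  have mE[measurable]: "E n a \<in> sets P" for n a
    unfolding E_def by (intro sets.finite_UN fin) measurable
  have "(\<Inter>n. E n a) \<in> null_sets P" for a
  proof -
    have "emeasure P (\<Inter>n. E n a) \<le> ennreal (q * (1 / 2) ^ n)" for n
    proof -
      have "emeasure P (\<Inter>n. E n a) \<le> emeasure P (E n a)"
        by (intro emeasure_mono) auto
      also have "\<dots> \<le> (\<Sum>zs\<in>{zs \<in> walks n a. distinct zs}.
          emeasure P {\<mu> \<in> space P. \<forall>z\<in>set zs. 1 \<le> emeasure \<mu> (cell s z)})"
        unfolding E_def by (intro emeasure_subadditive_finite fin image_subsetI) measurable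
      also have "\<dots> \<le> (\<Sum>zs\<in>{zs \<in> walks n a. distinct zs}. ennreal (q ^ Suc n))"
      proof (rule sum_mono)
        fix zs assume zs: "zs \<in> {zs \<in> walks n a. distinct zs}"
        then have "length zs = Suc n"
          using length_walks by blast
        then show "emeasure P {\<mu> \<in> space P. \<forall>z\<in>set zs. 1 \<le> emeasure \<mu> (cell s z)} \<le> ennreal (q ^ Suc n)"
          using occupied_cells_prob_le[OF P s, of zs] zs by (cases "zs = []") (auto simp: q_def)
      qed
      also have "\<dots> = ennreal (card {zs \<in> walks n a. distinct zs} * q ^ Suc n)"
        using q(1) by (simp add: ennreal_mult ennreal_of_nat_eq_real_of_nat)
      also have "\<dots> \<le> ennreal (real M ^ n * q ^ Suc n)"
      proof (intro ennreal_leI mult_right_mono)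
        have "card {zs \<in> walks n a. distinct zs} \<le> card (walks n a)"
          by (intro card_mono finite_walks) auto
        also have "\<dots> \<le> M ^ n"
          unfolding M_def by (rule card_walks_le)
        finally show "real (card {zs \<in> walks n a. distinct zs}) \<le> real M ^ n"
          by (metis of_nat_le_iff of_nat_power)
      qed (use q(1) in simp)
      \<comment> \<open>A walk of \<open>n\<close> steps has \<open>n + 1\<close> cells, which
        leaves one factor \<open>q\<close> over.\<close>
      also have "real M ^ n * q ^ Suc n = q * (real M * q) ^ n"
        by (simp add: power_mult_distrib)
      also have "\<dots> \<le> q * (1 / 2) ^ n"
        using q by (intro mult_left_mono power_mono) auto
      finally show ?thesis
        using ennreal_leI by (metis order_trans)
    qed
    moreover have "(\<lambda>n. ennreal (q * (1 / 2) ^ n)) \<longlonglongrightarrow> ennreal 0"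
      by (intro tendsto_ennrealI tendsto_mult_right_zero LIMSEQ_power_zero) simp
    ultimately have "emeasure P (\<Inter>n. E n a) \<le> ennreal 0"
      by (intro LIMSEQ_le_const[of "\<lambda>n. ennreal (q * (1 / 2) ^ n)"]) auto
    then show ?thesis
      by (intro null_setsI) auto
  qed
  then have "(\<Union>a. \<Inter>n. E n a) \<in> null_sets P"
    by (intro null_sets_UN)
  moreover have "{\<mu> \<in> space P. percolates (covered_set 1 \<mu> r)} \<subseteq> (\<Union>a. \<Inter>n. E n a)"
    using percolates_imp_occupied_walks[OF _ s r] point_process_space[OF P(1)]
    by (fastforce simp: E_def)
  \<comment> \<open>Monotonicity of \<open>emeasure\<close> asks for measurability of the larger set
    only, here the null set.\<close>
  ultimately have "emeasure P {\<mu> \<in> space P. percolates (covered_set 1 \<mu> r)} \<le> 0"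
    using emeasure_mono[of _ "\<Union>a. \<Inter>n. E n a" P] by (simp add: null_sets_def)
  then show ?thesis
    by (simp add: measure_def)
qed

subsection \<open>The upper bound\<close>

text \<open>The outer boundary of the bounded component \<open>G\<close> is connected, lies in the
  boxes of \<open>Z\<close> and crosses both half-axes. The crossing cell on the positive side has
  index \<open>j\<close> for some unknown \<open>j\<close>, and reaching the other side takes at
  least \<open>j\<close> steps; hence a walk whose length matches its starting point.\<close>

lemma bounded_component_meets_walk:
  fixes Z :: "(int ^ 'd) set" and s :: real
  defines "S \<equiv> \<Union>z\<in>Z. grid_box s (s / 2) z"
  assumes d: "2 \<le> CARD('d)" and s: "s > 0" and "0 \<notin> Z"
    and bdd: "bounded (connected_component_set (- S) 0)"
  shows "\<exists>j. \<exists>zs\<in>walks j (axis i (int j)). distinct zs \<and> set zs \<subseteq> Z"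
proof -
  define G where "G = connected_component_set (- S) 0"
  define line :: "real \<Rightarrow> real ^ 'd" where "line t = axis i t" for t
  \<comment> \<open>A box of half-side \<open>s / 2\<close> that meets the axis has its centre on
    the axis: the other coordinates of its index are integers of absolute value below 1.\<close>
  have on_line: "z $ k = 0" if "line t \<in> grid_box s (s / 2) z" "k \<noteq> i" for t z k
  proof -
    have "s * \<bar>of_int (z $ k)\<bar> \<le> s / 2"
      using that s by (auto simp: grid_box_def line_def axis_def abs_mult dest: spec[of _ k])
    then have "s * \<bar>of_int (z $ k)\<bar> < s * 1"
      using s by linarith
    then have "\<bar>of_int (z $ k) :: real\<bar> < 1"
      using s by (simp only: mult_less_cancel_left_pos)
    then show ?thesis by linarith
  qed
  have side: "0 \<le> t \<Longrightarrow> 0 \<le> z $ i" "t \<le> 0 \<Longrightarrow> z $ i \<le> 0" if "line t \<in> grid_box s (s / 2) z" for t z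
  proof -
    have b: "\<bar>t - s * of_int (z $ i)\<bar> \<le> s / 2"
      using that by (auto simp: grid_box_def line_def axis_def dest: spec[of _ i])
    { assume "0 \<le> t"
      then have "s * (- 1) < s * of_int (z $ i)"
        using b s by linarith
      then have "- 1 < (of_int (z $ i) :: real)"
        using s by (simp only: mult_less_cancel_left_pos)
      then show "0 \<le> z $ i" by linarith }
    { assume "t \<le> 0"
      then have "s * of_int (z $ i) < s * 1"
        using b s by linarith
      then have "(of_int (z $ i) :: real) < 1"
        using s by (simp only: mult_less_cancel_left_pos)
      then show "z $ i \<le> 0" by linarith }
  qed
  have "closed S"
    unfolding S_def by (rule closed_Union_grid_box[OF s])
  have "0 \<in> - S"
  proof -
    have "z = 0" if "0 \<in> grid_box s (s / 2) z" for z :: "int ^ 'd"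
    proof -
      have "line 0 = 0"
        by (simp add: line_def vec_eq_iff axis_def)
      then have "z $ k = 0" for k
        using on_line[of 0 z k] side[of 0 z] that by (cases "k = i") auto
      then show ?thesis by (simp add: vec_eq_iff)
    qed
    then show ?thesis
      using \<open>0 \<notin> Z\<close> by (auto simp: S_def)
  qed
  then have G: "0 \<in> G" "connected G" "G \<in> components (- S)"
    by (auto simp: G_def components_def)
  obtain R where R: "R > 0" "G \<subseteq> ball 0 R"
    using bdd bounded_subset_ballD[of G 0] unfolding G_def[symmetric] by auto
  have norm_line: "norm (line t) = \<bar>t\<bar>" for t
    by (simp add: line_def norm_eq_sqrt_inner inner_axis_axis)
  define C where "C = connected_component_set (- G) (line R)"
  \<comment> \<open>In dimension at least 2 the exterior of a ball is connected, which puts both far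
    ends of the axis into the same component \<open>C\<close>.\<close>
  have "connected (- ball (0 :: real ^ 'd) R)"
    using d by (intro connected_complement_bounded_convex) auto
  moreover have "- ball 0 R \<subseteq> - G"
    using R by blast
  moreover have "line R \<in> - ball 0 R" "line (- R) \<in> - ball 0 R"
    using R(1) by (simp_all add: norm_line)
  ultimately have inC: "line R \<in> C" "line (- R) \<in> C" and "C \<in> components (- G)"
    unfolding C_def components_def mem_Collect_eq
    by (meson connected_component_def connected_component_in subsetD imageI)+
  \<comment> \<open>Unicoherence enters here: each component of the complement of the connected set
    \<open>G\<close> has connected frontier.\<close>
  have "connected (frontier C)"
    using connected_frontier_component_complement[OF G(2) \<open>C \<in> components (- G)\<close>] .
  have "frontier C \<subseteq> frontier G"
    using frontier_of_components_subset[OF \<open>C \<in> components (- G)\<close>] by simp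
  also have "\<dots> \<subseteq> S"
    using frontier_of_components_closed_complement[OF \<open>closed S\<close> G(3)] .
  finally have cover: "frontier C \<subseteq> (\<Union>z\<in>Z. grid_box s (s / 2) z)"
    by (simp add: S_def)
  have "0 \<notin> C"
    using G(1) \<open>C \<in> components (- G)\<close> in_components_subset by blast
  have "line = (\<lambda>t. t *\<^sub>R axis i 1)"
    by (auto simp: line_def vec_eq_iff axis_def)
  then have cont: "continuous_on A line" for A
    by (simp only:) (intro continuous_intros)
  have crosses: "\<exists>t\<in>I. line t \<in> frontier C" if "connected I" "0 \<in> I" "u \<in> I" "line u \<in> C" for I u
  proof -
    have "connected (line ` I)"
      using that(1) cont by (rule connected_continuous_image[rotated])
    moreover have "line ` I \<inter> C \<noteq> {}"
      using that by blast
    moreover have "line 0 = 0"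
      by (simp add: line_def vec_eq_iff axis_def)
    then have "line ` I - C \<noteq> {}"
      using \<open>0 \<notin> C\<close> that(2) by force
    ultimately have "line ` I \<inter> frontier C \<noteq> {}"
      by (rule connected_Int_frontier)
    then show ?thesis by blast
  qed
  obtain t1 where t1: "0 \<le> t1" "line t1 \<in> frontier C"
    using crosses[of "{0..R}" R] inC R(1) by auto
  obtain t2 where t2: "t2 \<le> 0" "line t2 \<in> frontier C"
    using crosses[of "{-R..0}" "-R"] inC R(1) by auto
  obtain a where a: "a \<in> Z" "line t1 \<in> grid_box s (s / 2) a"
    using cover t1 by blast
  obtain b where b: "b \<in> Z" "line t2 \<in> grid_box s (s / 2) b"
    using cover t2 by blast
  define j where "j = nat (a $ i)"
  have ai: "0 \<le> a $ i" and bi: "b $ i \<le> 0"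
    using side(1)[OF a(2) t1(1)] side(2)[OF b(2) t2(1)] .
  have "a = axis i (int j)"
    using on_line[OF a(2)] ai by (auto simp: vec_eq_iff axis_def j_def)
  moreover have "int j \<le> \<bar>b $ i - a $ i\<bar>"
    using ai bi by (simp add: j_def)
  moreover have "s / 2 < s"
    using s by simp
  moreover have "frontier C \<inter> grid_box s (s / 2) a \<noteq> {}" "frontier C \<inter> grid_box s (s / 2) b \<noteq> {}"
    using a b t1 t2 by blast+
  ultimately show ?thesis
    using connected_cover_grid_boxes_walk[OF _ s \<open>connected (frontier C)\<close> cover a(1) _ b(1)] by blast
qed

text \<open>An unbounded connected set has points at every distance from \<open>y\<close>. At
  spacing \<open>3 * \<delta>\<close> the atoms within \<open>\<delta>\<close> of them are pairwise
  distinct, and those for \<open>m < k\<close> lie within \<open>3 * k * \<delta>\<close> of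
  \<open>y\<close>.\<close>

lemma unbounded_connected_subset_covered_set:
  fixes \<mu> :: "'a::euclidean_space measure"
  assumes \<mu>: "\<mu> \<in> counting_measures"
    and G: "connected G" "\<not> bounded G"
    and occ: "\<And>y. y \<in> G \<Longrightarrow> \<exists>x. 0 < emeasure \<mu> {x} \<and> dist y x \<le> \<delta>" and "\<delta> > 0"
  shows "G \<subseteq> covered_set k \<mu> (3 * real k * \<delta>)"
proof
  fix y assume y: "y \<in> G"
  have "\<exists>w\<in>G. dist y w = 3 * \<delta> * real m" for m
  proof -
    obtain w where w: "w \<in> G" "dist y w > 3 * \<delta> * real m"
      using G(2) unfolding bounded_def by (meson not_le)
    have "connected (dist y ` G)"
      using G(1) by (intro connected_continuous_image continuous_intros)
    then have "3 * \<delta> * real m \<in> dist y ` G"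
      using connectedD_interval[of "dist y ` G" "dist y y" "dist y w"] y w \<open>\<delta> > 0\<close> by auto
    then show ?thesis by force
  qed
  then obtain w where w: "\<And>m. w m \<in> G" "\<And>m. dist y (w m) = 3 * \<delta> * real m"
    by metis
  have "\<exists>x. 0 < emeasure \<mu> {x} \<and> dist (w m) x \<le> \<delta>" for m
    using occ[OF w(1)] .
  then obtain x where x: "\<And>m. 0 < emeasure \<mu> {x m}" "\<And>m. dist (w m) (x m) \<le> \<delta>"
    by metis
  have near: "\<bar>dist y (x m) - 3 * \<delta> * real m\<bar> \<le> \<delta>" for m
    using w(2)[of m] x(2)[of m] dist_triangle[of y "x m" "w m"] dist_triangle[of y "w m" "x m"]
    by (simp add: dist_commute abs_le_iff)
  have "inj x"
  proof (rule injI, rule ccontr)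
    fix m n assume "x m = x n" "m \<noteq> n"
    then have "\<bar>3 * \<delta> * real m - 3 * \<delta> * real n\<bar> \<le> 2 * \<delta>"
      using near[of m, unfolded \<open>x m = x n\<close>] near[of n] by linarith
    moreover have "\<bar>3 * \<delta> * real m - 3 * \<delta> * real n\<bar> = 3 * \<delta> * \<bar>real m - real n\<bar>"
      using \<open>\<delta> > 0\<close> by (simp add: abs_mult flip: right_diff_distrib)
    moreover have "3 * \<delta> * 1 \<le> 3 * \<delta> * \<bar>real m - real n\<bar>"
      using \<open>m \<noteq> n\<close> \<open>\<delta> > 0\<close> by (intro mult_left_mono) auto
    ultimately show False
      using \<open>\<delta> > 0\<close> by linarith
  qed
  have sub: "x ` {..<k} \<subseteq> cball y (3 * real k * \<delta>)"
  proof
    fix v assume "v \<in> x ` {..<k}"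
    then obtain m where m: "v = x m" "m < k" by blast
    then have "dist y v \<le> 3 * \<delta> * real m + \<delta>"
      unfolding m(1) using near[of m] by linarith
    also have "\<dots> \<le> 3 * \<delta> * (real m + 1)"
      using \<open>\<delta> > 0\<close> by (simp add: distrib_left)
    also have "\<dots> \<le> 3 * \<delta> * real k"
      using m(2) \<open>\<delta> > 0\<close> by (intro mult_left_mono) auto
    finally show "v \<in> cball y (3 * real k * \<delta>)"
      by (simp add: mult_ac)
  qed
  have "of_nat k = (\<Sum>v\<in>x ` {..<k}. 1 :: ennreal)"
    using \<open>inj x\<close> by (simp add: card_image inj_on_subset)
  also have "\<dots> \<le> (\<Sum>v\<in>x ` {..<k}. emeasure \<mu> {v})"
    using x(1) counting_measure_zero_or_ge_1[OF \<mu> bBs_singleton]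
    by (intro sum_mono) (metis imageE not_gr_zero)
  also have "\<dots> = emeasure \<mu> (x ` {..<k})"
    using counting_measuresD(1)[OF \<mu>] by (subst emeasure_eq_sum_singleton) auto
  also have "\<dots> \<le> emeasure \<mu> (cball y (3 * real k * \<delta>))"
    using sub counting_measuresD(1)[OF \<mu>] by (intro emeasure_mono) auto
  finally show "y \<in> covered_set k \<mu> (3 * real k * \<delta>)"
    by (simp add: covered_set_eq[OF \<mu>])
qed

text \<open>The component of the origin off the closed empty cells is unbounded and stays in
  occupied cells, so every point of it has an atom nearby. Emptiness of a walk is phrased by the
  union of its cells because \<nu>-weak sub-Poissonianity concerns single sets.\<close>

lemma percolates_if_no_empty_walks:
  fixes \<mu> :: "(real ^ 'd) measure" and s :: real
  assumes \<mu>: "\<mu> \<in> counting_measures" and s: "s > 0" and d: "2 \<le> CARD('d)"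
    and no_walk: "\<And>j zs. zs \<in> walks j (axis i (int j)) \<Longrightarrow> distinct zs \<Longrightarrow>
      emeasure \<mu> (\<Union>z\<in>set zs. cell s z) \<noteq> 0"
  shows "percolates (covered_set k \<mu> (3 * real k * (s * CARD('d))))"
proof -
  define Z where "Z = {z. emeasure \<mu> (cell s z) = 0}"
  define S where "S = (\<Union>z\<in>Z. grid_box s (s / 2) z)"
  define G where "G = connected_component_set (- S) 0"
  have mcell: "cell s z \<in> sets \<mu>" for z
    using bBs_cell[OF s, of z] counting_measuresD(1)[OF \<mu>] by (simp add: bBs_def)
  have no_walk': "\<not> (\<exists>j. \<exists>zs\<in>walks j (axis i (int j)). distinct zs \<and> set zs \<subseteq> Z)"
  proof (intro notI, elim exE bexE conjE)
    fix j zs assume zs: "zs \<in> walks j (axis i (int j))" "distinct zs" "set zs \<subseteq> Z"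
    have "emeasure \<mu> (\<Union>z\<in>set zs. cell s z) = 0"
      using zs(3) mcell by (intro null_setsD1 null_sets_UN') (auto simp: Z_def)
    with no_walk[OF zs(1,2)] show False ..
  qed
  have ax0: "axis i 0 = (0 :: int ^ 'd)"
    by (simp add: vec_eq_iff axis_def)
  have "0 \<notin> Z"
  proof
    assume "0 \<in> Z"
    \<comment> \<open>The case \<open>j = 0\<close>: the walk consists of the cell of the origin
      alone.\<close>
    then have "\<exists>zs\<in>walks 0 (axis i (int 0)). distinct zs \<and> set zs \<subseteq> Z"
      by (simp add: ax0)
    with no_walk' show False by blast
  qed
  then have "\<not> bounded G"
    using bounded_component_meets_walk[OF d s, of Z i] no_walk' unfolding G_def S_def by blast
  moreover have "connected G"
    by (simp add: G_def)
  moreover have "\<exists>x. 0 < emeasure \<mu> {x} \<and> dist y x \<le> s * CARD('d)" if "y \<in> G" for y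
  proof -
    define z where "z = (\<chi> i. round (y $ i / s))"
    have yz: "y \<in> cell s z"
      by (simp add: in_cell_iff z_def)
    have "y \<notin> S"
      using \<open>y \<in> G\<close> connected_component_subset unfolding G_def by blast
    then have "z \<notin> Z"
      using yz cell_subset_grid_box[OF s, of z] by (auto simp: S_def)
    then have "0 < emeasure \<mu> (cell s z)"
      by (simp add: Z_def zero_less_iff_neq_zero)
    then obtain x where x: "x \<in> cell s z" "0 < emeasure \<mu> {x}"
      using counting_measure_atom_exists[OF \<mu> bBs_cell[OF s]] by blast
    \<comment> \<open>The sum norm gives the crude diameter bound \<open>s * CARD('d)\<close> for a
      cell.\<close>
    have "dist y x \<le> (\<Sum>i\<in>UNIV. \<bar>(y - x) $ i\<bar>)"
      unfolding dist_norm by (rule norm_le_l1_cart)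
    also have "\<dots> \<le> (\<Sum>i\<in>(UNIV :: 'd set). s)"
    proof (rule sum_mono)
      fix i
      have "\<bar>x $ i - s * of_int (z $ i)\<bar> \<le> s / 2" "\<bar>y $ i - s * of_int (z $ i)\<bar> \<le> s / 2"
        using cell_subset_grid_box[OF s, of z] x(1) yz by (auto simp: grid_box_def)
      then show "\<bar>(y - x) $ i\<bar> \<le> s"
        unfolding vector_minus_component by linarith
    qed
    finally show ?thesis
      using x(2) by (auto simp: mult.commute)
  qed
  moreover have "0 < s * CARD('d)"
    using s by simp
  ultimately have "G \<subseteq> covered_set k \<mu> (3 * real k * (s * CARD('d)))"
    using unbounded_connected_subset_covered_set[OF \<mu>] by blast
  then show ?thesis
    using \<open>connected G\<close> \<open>\<not> bounded G\<close> unfolding percolates_def by blast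
qed

section \<open>Void probabilities of families of cells\<close>

lemma empty_cells_prob_le:
  fixes P :: "(real ^ 'd) measure measure" and s :: real
  assumes P: "point_process P" "has_intensity P l" "nu_weakly_sub_Poisson P" and s: "s > 0"
    and zs: "distinct zs"
  shows "measure P {\<mu> \<in> space P. emeasure \<mu> (\<Union>z\<in>set zs. cell s z) = 0}
    \<le> exp (- (l * s ^ CARD('d))) ^ length zs"
proof -
  let ?V = "\<Union>z\<in>set zs. cell s z"
  have "l > 0"
    using P(2) by (simp add: has_intensity_def)
  have V: "bBs ?V"
    using bBs_cell[OF s] by (auto simp: bBs_def)
  \<comment> \<open>Additivity over disjoint cells makes the mean proportional to the number of
    cells, so a single void probability is bounded by a power. The mean is finite, so
    \<open>exp_minus\<close> is the ordinary exponential.\<close>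
  have "emeasure lborel ?V = (\<Sum>z\<in>set zs. emeasure lborel (cell s z))"
    using bBs_cell[OF s] disjoint_cell by (intro sum_emeasure[symmetric]) (auto simp: bBs_def)
  also have "\<dots> = ennreal (length zs * s ^ CARD('d))"
    using s by (simp add: emeasure_cell distinct_card[OF zs] ennreal_mult ennreal_of_nat_eq_real_of_nat)
  finally have "mean_count P ?V = ennreal (l * (length zs * s ^ CARD('d)))"
    using P(2) V s \<open>l > 0\<close> by (simp add: has_intensity_def bBs_def ennreal_mult)
  moreover have "measure P {\<mu> \<in> space P. emeasure \<mu> ?V = 0} \<le> exp_minus (mean_count P ?V)"
    using P(3) V by (simp add: nu_weakly_sub_Poisson_def)
  ultimately show ?thesis
    using s \<open>l > 0\<close> by (simp add: exp_minus_def mult_ac flip: exp_of_nat_mult)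
qed

text \<open>The union bound over \<open>j\<close> and the walks gives at most 1/4 + 1/16 + ... = 1/3
  for the existence of an empty walk, so percolation has probability at least 2/3.\<close>

lemma percolation_large_radius:
  fixes P :: "(real ^ 'd) measure measure" and s :: real
  assumes d: "2 \<le> CARD('d)"
    and P: "point_process P" "has_intensity P l" "nu_weakly_sub_Poisson P" and s: "s > 0"
    and small: "card {b :: int ^ 'd. adjacent 0 b} * exp (- (l * s ^ CARD('d))) \<le> 1 / 4"
  shows "measure P {\<mu> \<in> space P. percolates (covered_set k \<mu> (3 * real k * (s * CARD('d))))} > 0"
proof -
  interpret prob_space P
    using P(1) by (simp add: point_process_def)
  let ?E = "{\<mu> \<in> space P. percolates (covered_set k \<mu> (3 * real k * (s * CARD('d))))}"
  define i where "i = (SOME i :: 'd. True)"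
  define M where "M = card {b :: int ^ 'd. adjacent 0 b}"
  define q where "q = exp (- (l * s ^ CARD('d)))"
  have "1 \<le> M"
    unfolding M_def by (rule one_le_card_adjacent)
  have q: "0 \<le> q" "real M * q \<le> 1 / 4"
    using small by (auto simp: q_def M_def)
  define W where "W j = {zs \<in> walks j (axis i (int j)). distinct zs}" for j
  define F where "F j = (\<Union>zs\<in>W j. {\<mu> \<in> space P. emeasure \<mu> (\<Union>z\<in>set zs. cell s z) = 0})" for j
  have fin: "finite (W j)" for j
    by (simp add: W_def finite_walks)
  have [measurable]: "(\<lambda>\<mu>. emeasure \<mu> (\<Union>z\<in>set zs. cell s z)) \<in> borel_measurable P" for zs :: "(int ^ 'd) list"
    using bBs_cell[OF s] by (intro point_process_measurable_emeasure[OF P(1)]) (auto simp: bBs_def)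
  have mF: "F j \<in> sets P" for j
    unfolding F_def by (intro sets.finite_UN fin) measurable
  have F_le: "measure P (F j) \<le> (1 / 4) ^ Suc j" for j
  proof -
    have "measure P (F j) \<le> (\<Sum>zs\<in>W j. measure P {\<mu> \<in> space P. emeasure \<mu> (\<Union>z\<in>set zs. cell s z) = 0})"
      unfolding F_def by (intro finite_measure_subadditive_finite fin image_subsetI) measurable
    also have "\<dots> \<le> (\<Sum>zs\<in>W j. q ^ Suc j)"
    proof (rule sum_mono)
      fix zs assume "zs \<in> W j"
      then have "distinct zs" "length zs = Suc j"
        using length_walks by (auto simp: W_def)
      then show "measure P {\<mu> \<in> space P. emeasure \<mu> (\<Union>z\<in>set zs. cell s z) = 0} \<le> q ^ Suc j"
        using empty_cells_prob_le[OF P s, of zs] by (simp add: q_def)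
    qed
    also have "\<dots> = real (card (W j)) * q ^ Suc j"
      by simp
    also have "\<dots> \<le> real M ^ Suc j * q ^ Suc j"
    proof (rule mult_right_mono)
      have "card (W j) \<le> card (walks j (axis i (int j)))"
        unfolding W_def by (intro card_mono finite_walks) auto
      also have "\<dots> \<le> M ^ j"
        unfolding M_def by (rule card_walks_le)
      \<comment> \<open>One power of \<open>M\<close> is given away to match the exponent of
        \<open>q\<close>, which counts cells instead of steps.\<close>
      also have "\<dots> \<le> M ^ Suc j"
        using \<open>1 \<le> M\<close> by (intro power_increasing) auto
      finally show "real (card (W j)) \<le> real M ^ Suc j"
        by (metis of_nat_le_iff of_nat_power)
    qed (use q(1) in simp)
    also have "\<dots> = (real M * q) ^ Suc j"
      by (simp only: power_mult_distrib)
    also have "\<dots> \<le> (1 / 4) ^ Suc j"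
      using q by (intro power_mono) auto
    finally show ?thesis .
  qed
  have geo: "(\<lambda>j. (1 / 4 :: real) ^ Suc j) sums (1 / 3)"
    using sums_mult[OF geometric_sums[of "1 / 4 :: real"], of "1 / 4"] by simp
  have sF: "summable (\<lambda>j. measure P (F j))"
    using F_le by (intro summable_comparison_test'[OF sums_summable[OF geo]]) auto
  have "measure P (\<Union>j. F j) \<le> (\<Sum>j. measure P (F j))"
    using mF sF by (intro finite_measure_subadditive_countably) auto
  also have "\<dots> \<le> (\<Sum>j. (1 / 4) ^ Suc j)"
    using F_le sF sums_summable[OF geo] by (rule suminf_le)
  also have "\<dots> = 1 / 3"
    using geo by (rule sums_unique[symmetric])
  finally have UF: "measure P (\<Union>j. F j) \<le> 1 / 3" .
  \<comment> \<open>Bounding the probability of \<open>?E\<close> from below by that of a subset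
    requires \<open>?E\<close> itself to be measurable.\<close>
  have mE: "?E \<in> sets P"
    using percolation_event_measurable[of k "3 * real k * (s * CARD('d))", where 'a = "real ^ 'd"] P(1)
      point_process_space[OF P(1)] by (simp add: point_process_def space_config_space)
  have "space P - (\<Union>j. F j) \<subseteq> ?E"
  proof
    fix \<mu> assume \<mu>: "\<mu> \<in> space P - (\<Union>j. F j)"
    then have "emeasure \<mu> (\<Union>z\<in>set zs. cell s z) \<noteq> 0"
      if "zs \<in> walks j (axis i (int j))" "distinct zs" for j zs
      using that by (auto simp: F_def W_def)
    then show "\<mu> \<in> ?E"
      using percolates_if_no_empty_walks[OF _ s d, of \<mu> i k] \<mu> point_process_space[OF P(1)] by auto
  qed
  then have "measure P (space P - (\<Union>j. F j)) \<le> measure P ?E"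
    using mE by (rule finite_measure_mono)
  moreover have "measure P (space P - (\<Union>j. F j)) = 1 - measure P (\<Union>j. F j)"
    using mF by (intro prob_compl) auto
  ultimately show ?thesis
    using UF by linarith
qed

text \<open>Both constants are built from \<open>l\<close>, the dimension and, for the upper one,
  \<open>k\<close>, before any law is chosen. The upper bound asks for dimension at least 2: on the
  line a Poisson process leaves gaps at every radius, so its critical radius is infinite.\<close>

theorem theorem3p7:
  fixes l :: real
  assumes "0 < l"
  shows "\<exists>c::real. 0 < c \<and>
     (\<forall>P :: (real ^ 'd) measure measure.
        point_process P \<and> simple_process P \<and> stationary_process P \<and> has_intensity P l \<and>
        alpha_weakly_sub_Poisson P \<longrightarrow> ereal c \<le> critical_radius 1 P) \<and>
     (\<forall>k\<ge>1. \<exists>C::real.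
        \<forall>P :: (real ^ 'd) measure measure.
        2 \<le> CARD('d) \<and>
        point_process P \<and> simple_process P \<and> stationary_process P \<and> has_intensity P l \<and>
        nu_weakly_sub_Poisson P \<longrightarrow> critical_radius k P \<le> ereal C)"
proof -
  define M where "M = real (card {b :: int ^ 'd. adjacent 0 b})"
  have M: "1 \<le> M"
    using one_le_card_adjacent[where 'd = 'd] by (simp add: M_def)
  \<comment> \<open>The cap 1 gives \<open>s ^ CARD('d) \<le> s\<close>, and the other bound makes
    \<open>M * (l * s)\<close> at most 1/2.\<close>
  define s where "s = min 1 (1 / (2 * l * M))"
  have s: "0 < s"
    using \<open>0 < l\<close> M by (simp add: s_def)
  have small: "M * (l * s ^ CARD('d)) \<le> 1 / 2"
  proof -
    have "s ^ CARD('d) \<le> s ^ 1"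
      using s by (intro power_decreasing) (auto simp: s_def Suc_leI)
    also have "\<dots> \<le> 1 / (2 * l * M)"
      by (simp add: s_def)
    finally show ?thesis
      using \<open>0 < l\<close> M by (simp add: field_simps)
  qed
  have lower: "ereal (s / 2) \<le> critical_radius 1 P"
    if P: "point_process P" "has_intensity P l" "alpha_weakly_sub_Poisson P"
    for P :: "(real ^ 'd) measure measure"
    unfolding critical_radius_def
  proof (rule INF_greatest)
    fix r assume "r \<in> {r. 0 \<le> r \<and> 0 < measure P {\<mu> \<in> space P. percolates (covered_set 1 \<mu> r)}}"
    then have r: "0 \<le> r" "measure P {\<mu> \<in> space P. percolates (covered_set 1 \<mu> r)} \<noteq> 0"
      by auto
    then have "\<not> r < s / 2"
      using no_percolation_small_radius[OF P s small[unfolded M_def] r(1)] by blast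
    then show "ereal (s / 2) \<le> ereal r"
      by simp
  qed
  \<comment> \<open>The value \<open>ln (4 * M) / l\<close> solves
    \<open>M * exp (- (l * t)) = 1 / 4\<close>; being at least 1, \<open>t\<close> satisfies
    \<open>t \<le> t ^ CARD('d)\<close>.\<close>
  define t where "t = max 1 (ln (4 * M) / l)"
  have t: "0 < t"
    by (simp add: t_def)
  have large: "M * exp (- (l * t ^ CARD('d))) \<le> 1 / 4"
  proof -
    have "ln (4 * M) \<le> l * t"
      using \<open>0 < l\<close> by (simp add: t_def field_simps max_def)
    also have "t ^ 1 \<le> t ^ CARD('d)"
      by (intro power_increasing) (auto simp: t_def Suc_leI)
    then have "l * t \<le> l * t ^ CARD('d)"
      using \<open>0 < l\<close> by simp
    finally have "exp (- (l * t ^ CARD('d))) \<le> exp (- ln (4 * M))"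
      by simp
    also have "\<dots> = 1 / (4 * M)"
      using M by (simp add: exp_minus inverse_eq_divide)
    finally show ?thesis
      using M by (simp add: field_simps)
  qed
  have upper: "critical_radius k P \<le> ereal (3 * real k * (t * CARD('d)))"
    if "2 \<le> CARD('d)" "point_process P" "has_intensity P l" "nu_weakly_sub_Poisson P"
    for k and P :: "(real ^ 'd) measure measure"
    unfolding critical_radius_def
    using percolation_large_radius[OF that t large[unfolded M_def], of k] t
    by (intro INF_lower) simp
  show ?thesis
    using lower upper s by (intro exI[of _ "s / 2"] conjI allI impI exI) auto
qed

end
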